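(* Let $p\ge5$ be a prime. Consider the set $\mathcal{R}^*$ of all groups $\langle s,r,A\rangle$ and $\langle s, r z_{2^{n+1}}, A\rangle$, where $A$ ranges over the finite subgroups of $\mathrm{D}(p,\mathbb{C})$ that are invariant under conjugation by $\mathrm{Sym}(p)$ and are not contained in the group of scalar matrices, and $2^n=|A\cap Z_{\{2\}}|$. Then every group in $\mathcal{R}^*$ is a finite irreducible subgroup of $\mathrm{M}(p,\mathbb{C})$ with permutation part $\mathrm{Sym}(p)$; every finite irreducible subgroup of $\mathrm{M}(p,\mathbb{C})$ with permutation part $\mathrm{Sym}(p)$ is $\mathrm{GL}(p,\mathbb{C})$-conjugate to a group in $\mathcal{R}^*$; and no two distinct groups in $\mathcal{R}^*$ are $\mathrm{GL}(p,\mathbb{C})$-conjugate.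
   Context: $\mathrm{M}(p,\mathbb{C})$ is the group of monomial matrices, $\mathrm{D}(p,\mathbb{C})$ the invertible diagonal matrices, and $\mathrm{Sym}(p)$ is identified with the permutation matrices via $\alpha\mapsto[\delta_{i\alpha,j}]_{i,j}$. The permutation part of $G\le \mathrm{M}(p,\mathbb{C})$ is its image under $dt\mapsto t$ ($d$ diagonal, $t$ a permutation matrix). $s$ is the permutation matrix of $(1,2,\ldots,p)$ and $r$ that of the transposition $(1,2)$. $z_m$ denotes the scalar matrix $e^{2\pi i/m}I_p$, and $Z_{\{2\}}$ the group of scalar matrices of $2$-power order. *)

theory Defs
  imports "Jordan_Normal_Form.Matrix" "HOL-Combinatorics.Permutations" Complex_Main
begin

definition perm_mat :: "nat \<Rightarrow> (nat \<Rightarrow> nat) \<Rightarrow> complex mat" where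
  "perm_mat p \<alpha> = mat p p (\<lambda>(i,j). if \<alpha> i = j then 1 else 0)"

definition Sym :: "nat \<Rightarrow> (nat \<Rightarrow> nat) set" where
  "Sym p = {\<alpha>. \<alpha> permutes {..<p}}"

definition s_mat :: "nat \<Rightarrow> complex mat" where
  "s_mat p = perm_mat p (\<lambda>i. if i < p then (i + 1) mod p else i)"

definition r_mat :: "nat \<Rightarrow> complex mat" where
  "r_mat p = perm_mat p (Transposition.transpose 0 1)"

definition scalar_mat :: "nat \<Rightarrow> complex \<Rightarrow> complex mat" where
  "scalar_mat p c = c \<cdot>\<^sub>m 1\<^sub>m p"

definition z_mat :: "nat \<Rightarrow> nat \<Rightarrow> complex mat" where
  "z_mat p m = scalar_mat p (cis (2 * pi / real m))"

definition scalars :: "nat \<Rightarrow> complex mat set" where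
  "scalars p = {scalar_mat p c | c. c \<noteq> 0}"

definition Z2 :: "nat \<Rightarrow> complex mat set" where
  "Z2 p = {scalar_mat p c | c. \<exists>k::nat. c ^ (2 ^ k) = 1}"

definition matgroup :: "nat \<Rightarrow> complex mat set \<Rightarrow> bool" where
  "matgroup p G \<longleftrightarrow> G \<subseteq> carrier_mat p p \<and> 1\<^sub>m p \<in> G \<and>
     (\<forall>x\<in>G. \<forall>y\<in>G. x * y \<in> G) \<and>
     (\<forall>x\<in>G. \<exists>y\<in>G. x * y = 1\<^sub>m p \<and> y * x = 1\<^sub>m p)"

definition gen_group :: "nat \<Rightarrow> complex mat set \<Rightarrow> complex mat set" where
  "gen_group p S = \<Inter>{H. matgroup p H \<and> S \<subseteq> H}"

definition monomial_mats :: "nat \<Rightarrow> complex mat set" where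
  "monomial_mats p = {g \<in> carrier_mat p p.
      (\<forall>i<p. \<exists>!j. j < p \<and> g $$ (i,j) \<noteq> 0) \<and> (\<forall>j<p. \<exists>!i. i < p \<and> g $$ (i,j) \<noteq> 0)}"

definition diag_mats :: "nat \<Rightarrow> complex mat set" where
  "diag_mats p = {d \<in> carrier_mat p p.
      (\<forall>i<p. \<forall>j<p. i \<noteq> j \<longrightarrow> d $$ (i,j) = 0) \<and> (\<forall>i<p. d $$ (i,i) \<noteq> 0)}"

text \<open>Permutation part: image under d t |-> t, where g = d t has g(i,j) nonzero iff j = alpha i.\<close>
definition perm_part :: "nat \<Rightarrow> complex mat set \<Rightarrow> (nat \<Rightarrow> nat) set" where
  "perm_part p G = {\<alpha>. \<alpha> permutes {..<p} \<and>
      (\<exists>g\<in>G. \<forall>i<p. \<forall>j<p. g $$ (i,j) \<noteq> 0 \<longleftrightarrow> j = \<alpha> i)}"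

definition invariant_subspace :: "nat \<Rightarrow> complex mat set \<Rightarrow> complex vec set \<Rightarrow> bool" where
  "invariant_subspace p G W \<longleftrightarrow> W \<subseteq> carrier_vec p \<and> 0\<^sub>v p \<in> W \<and>
     (\<forall>v\<in>W. \<forall>w\<in>W. v + w \<in> W) \<and> (\<forall>c. \<forall>v\<in>W. c \<cdot>\<^sub>v v \<in> W) \<and>
     (\<forall>g\<in>G. \<forall>v\<in>W. g *\<^sub>v v \<in> W)"

definition irreducible_mats :: "nat \<Rightarrow> complex mat set \<Rightarrow> bool" where
  "irreducible_mats p G \<longleftrightarrow>
     (\<forall>W. invariant_subspace p G W \<longrightarrow> W = {0\<^sub>v p} \<or> W = carrier_vec p)"

definition GL_conjugate :: "nat \<Rightarrow> complex mat set \<Rightarrow> complex mat set \<Rightarrow> bool" where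
  "GL_conjugate p G H \<longleftrightarrow> (\<exists>X Y. X \<in> carrier_mat p p \<and> Y \<in> carrier_mat p p \<and>
     X * Y = 1\<^sub>m p \<and> Y * X = 1\<^sub>m p \<and> H = (\<lambda>g. X * g * Y) ` G)"

definition admissible_A :: "nat \<Rightarrow> complex mat set \<Rightarrow> bool" where
  "admissible_A p A \<longleftrightarrow> matgroup p A \<and> finite A \<and> A \<subseteq> diag_mats p \<and>
     (\<forall>\<alpha>\<in>Sym p. \<forall>a\<in>A. perm_mat p \<alpha> * a * perm_mat p (inv_into UNIV \<alpha>) \<in> A) \<and>
     \<not> A \<subseteq> scalars p"

definition R_star :: "nat \<Rightarrow> complex mat set set" where
  "R_star p = {G. \<exists>A. admissible_A p A \<and>
     (G = gen_group p ({s_mat p, r_mat p} \<union> A) \<or>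
      (\<exists>n. card (A \<inter> Z2 p) = 2 ^ n \<and>
           G = gen_group p ({s_mat p, r_mat p * z_mat p (2 ^ (n + 1))} \<union> A)))}"

end

(* Entrywise powers of monomial matrices are compatible with multiplication. Let D be the diagonal
   part of a group G as in the second claim and m the order of the group of all ratios d_i/d_j of
   entries of elements of D. The m-th powers of the entry ratios of the lifts of a permutation t
   depend only on t, and a transitivity argument with p >= 5 points shows that this cocycle is a
   coboundary; conjugating G by a suitable diagonal matrix therefore makes all entry ratios m-th
   roots of unity. As D contains every diagonal matrix of determinant 1 whose entries are m-th roots
   of unity, Sym(p) now acts trivially on the coefficients of lifts modulo D, and since p is odd the
   lifts of transpositions can be chosen as a scalar of 2-power order times the transposition.
   If D were scalar, this form of G would exhibit a common eigenvector.
   For the last claim, the diagonal part is the largest abelian normal subgroup, and a matrix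
   conjugating one diagonal part to another must be monomial, so the diagonal parts coincide. A
   conjugation between the two kinds of groups would force z_{2^(n+1)} into A. *)

theory Submission
  imports Defs "HOL-Computational_Algebra.Primes"
begin

section \<open>Monomial matrices and permutations\<close>

text \<open>Both families are treated as one: \<open>ext_group p A w\<close> puts the scalar
  \<open>w\<close> on odd permutations, with w = 1 or w = z_{2^(n+1)}. The handle on a diagonal
  group A is the quotient of a by its image under a transposition (i j): it lives on two
  coordinates, with entries a_i/a_j and a_j/a_i. Such elements generate all diagonal matrices of
  determinant 1 with entries in the ratio group, so membership in A can be shown by checking entries
  and one product. Oddness of p works through two expressions in the coefficients e_i of a
  normalized lift of an involution: e_i^p / (product of the e_k) has determinant 1 and entries in
  the ratio group, and e_i^(p-1) is a power of e_i^2. Both lie in D, and their quotient turns the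
  lift into a scalar one. The bound p >= 5 is felt twice. In Sym(4) the Klein four-group is abelian
  and normal, which would spoil the recognition of the diagonal part. And the cocycle could restrict
  to the sign character on a two-point stabilizer, which is excluded by comparing three points off a
  transposition.\<close>

abbreviation pinv :: "(nat \<Rightarrow> nat) \<Rightarrow> nat \<Rightarrow> nat" where
  "pinv t \<equiv> inv_into UNIV t"

text \<open>Rows index the support, matching the convention [delta_{i alpha, j}] for permutation
  matrices; products therefore compose permutations in reverse order. Values of \<open>d\<close>
  from \<open>p\<close> on are junk, whence the congruence rules restricted to indices below
  \<open>p\<close>.\<close>

definition mon :: "nat \<Rightarrow> (nat \<Rightarrow> complex) \<Rightarrow> (nat \<Rightarrow> nat) \<Rightarrow> complex mat" where
  "mon p d t = mat p p (\<lambda>(i,j). if j = t i then d i else 0)"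

lemma mon_carrier [simp]: "mon p d t \<in> carrier_mat p p"
  by (simp add: mon_def)

lemma mon_dim [simp]: "dim_row (mon p d t) = p" "dim_col (mon p d t) = p"
  by (simp_all add: mon_def)

lemma mon_index [simp]:
  "i < p \<Longrightarrow> j < p \<Longrightarrow> mon p d t $$ (i,j) = (if j = t i then d i else 0)"
  by (simp add: mon_def)

lemma mon_cong: "(\<And>i. i < p \<Longrightarrow> d i = e i) \<Longrightarrow> mon p d t = mon p e t"
  by (auto intro!: eq_matI)

lemma permutes_less:
  fixes t :: "nat \<Rightarrow> nat"
  shows "t permutes {..<p} \<Longrightarrow> t i < p \<longleftrightarrow> i < p"
  using permutes_in_image[of t "{..<p}" i] by simp

lemma mon_mult:
  assumes "t permutes {..<p}"
  shows "mon p d t * mon p e u = mon p (\<lambda>i. d i * e (t i)) (u \<circ> t)"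
proof (rule eq_matI)
  fix i j assume "i < dim_row (mon p (\<lambda>i. d i * e (t i)) (u \<circ> t))"
    "j < dim_col (mon p (\<lambda>i. d i * e (t i)) (u \<circ> t))"
  hence ij: "i < p" "j < p" by auto
  have ti: "t i < p" using assms ij permutes_less by auto
  have "(mon p d t * mon p e u) $$ (i,j)
      = (\<Sum>k\<in>{0..<p}. (if k = t i then d i else 0) * (if j = u k then e k else 0))"
    using ij by (simp add: scalar_prod_def)
  also have "\<dots> = (\<Sum>k\<in>{0..<p}. if k = t i then d i * (if j = u k then e k else 0) else 0)"
    by (rule sum.cong) auto
  also have "\<dots> = d i * (if j = u (t i) then e (t i) else 0)"
    using ti by (subst sum.delta) auto
  finally show "(mon p d t * mon p e u) $$ (i,j) = mon p (\<lambda>i. d i * e (t i)) (u \<circ> t) $$ (i,j)"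
    using ij by simp
qed auto

lemma mon_one: "mon p (\<lambda>_. 1) id = 1\<^sub>m p"
  by (rule eq_matI) auto

text \<open>Since \<open>d\<close> has no zero below \<open>p\<close>, the support of row i pins
  down \<open>t i\<close>; from \<open>p\<close> on both permutations are the identity, so they
  agree as functions.\<close>

lemma mon_eqD:
  assumes eq: "mon p d t = mon p e u" and t: "t permutes {..<p}" and u: "u permutes {..<p}"
    and nz: "\<And>i. i < p \<Longrightarrow> d i \<noteq> 0"
  shows "t = u" "\<And>i. i < p \<Longrightarrow> d i = e i"
proof -
  have *: "t i = u i \<and> d i = e i" if i: "i < p" for i
  proof -
    have ti: "t i < p" using t i permutes_less by auto
    have "mon p e u $$ (i, t i) = d i"
      unfolding eq[symmetric] using i ti by simp
    thus ?thesis using i ti nz[OF i] by (auto split: if_splits)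
  qed
  show "t = u"
  proof
    fix i show "t i = u i"
      using * permutes_not_in[OF t, of i] permutes_not_in[OF u, of i] by (cases "i < p") auto
  qed
  show "\<And>i. i < p \<Longrightarrow> d i = e i" using * by auto
qed

lemma mon_inverse:
  assumes t: "t permutes {..<p}" and nz: "\<And>i. i < p \<Longrightarrow> d i \<noteq> 0"
  shows "mon p d t * mon p (\<lambda>i. inverse (d (pinv t i))) (pinv t) = 1\<^sub>m p"
    and "mon p (\<lambda>i. inverse (d (pinv t i))) (pinv t) * mon p d t = 1\<^sub>m p"
proof -
  have it: "pinv t permutes {..<p}" using t by (rule permutes_inv)
  have e: "pinv t \<circ> t = id" "t \<circ> pinv t = id" using permutes_inv_o[OF t] by auto
  have f: "pinv t (t i) = i" for i using permutes_inverses[OF t] by auto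
  show "mon p d t * mon p (\<lambda>i. inverse (d (pinv t i))) (pinv t) = 1\<^sub>m p"
    unfolding mon_mult[OF t] e mon_one[symmetric] by (rule mon_cong) (simp add: f nz)
  show "mon p (\<lambda>i. inverse (d (pinv t i))) (pinv t) * mon p d t = 1\<^sub>m p"
    unfolding mon_mult[OF it] e mon_one[symmetric]
    by (rule mon_cong) (use permutes_less[OF it] nz in auto)
qed

lemma mon_in_monomial_mats:
  assumes t: "t permutes {..<p}" and nz: "\<And>i. i < p \<Longrightarrow> d i \<noteq> 0"
  shows "mon p d t \<in> monomial_mats p"
proof -
  have "\<exists>!j. j < p \<and> mon p d t $$ (i,j) \<noteq> 0" if i: "i < p" for i
  proof (rule ex1I)
    have "t i < p" using i permutes_less[OF t] by blast
    thus "t i < p \<and> mon p d t $$ (i, t i) \<noteq> 0" using i nz[OF i] by simp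
    show "\<And>j. j < p \<and> mon p d t $$ (i,j) \<noteq> 0 \<Longrightarrow> j = t i"
      using i by (auto split: if_splits)
  qed
  moreover have "\<exists>!i. i < p \<and> mon p d t $$ (i,j) \<noteq> 0" if j: "j < p" for j
  proof (rule ex1I)
    have ij: "pinv t j < p" using j permutes_less[OF permutes_inv[OF t]] by blast
    thus "pinv t j < p \<and> mon p d t $$ (pinv t j, j) \<noteq> 0"
      using j nz[OF ij] permutes_inverses(1)[OF t] by simp
    show "\<And>i. i < p \<and> mon p d t $$ (i,j) \<noteq> 0 \<Longrightarrow> i = pinv t j"
      using j permutes_inverses(2)[OF t] by (auto split: if_splits)
  qed
  ultimately show ?thesis by (auto simp: monomial_mats_def)
qed

lemma monomial_matsE:
  assumes "g \<in> monomial_mats p"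
  obtains d t where "t permutes {..<p}" "\<And>i. i < p \<Longrightarrow> d i \<noteq> 0" "g = mon p d t"
proof -
  have g: "g \<in> carrier_mat p p"
    and row: "\<And>i. i < p \<Longrightarrow> \<exists>!j. j < p \<and> g $$ (i,j) \<noteq> 0"
    and col: "\<And>j. j < p \<Longrightarrow> \<exists>!i. i < p \<and> g $$ (i,j) \<noteq> 0"
    using assms by (auto simp: monomial_mats_def)
  define t where "t i = (if i < p then (THE j. j < p \<and> g $$ (i,j) \<noteq> 0) else i)" for i
  have t: "t i < p" "g $$ (i, t i) \<noteq> 0" if "i < p" for i
    using theI'[OF row[OF that]] that by (auto simp: t_def)
  have uniq: "j = t i" if "i < p" "j < p" "g $$ (i,j) \<noteq> 0" for i j
    using row[OF that(1)] t[OF that(1)] that by blast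
  have "inj_on t {..<p}"
  proof (rule inj_onI)
    fix i k assume "i \<in> {..<p}" "k \<in> {..<p}" "t i = t k"
    thus "i = k" using col[of "t i"] t[of i] t[of k] by auto
  qed
  hence "t permutes {..<p}"
    using t(1) by (intro inj_imp_permutes) (simp_all add: t_def)
  moreover have "g = mon p (\<lambda>i. g $$ (i, t i)) t"
  proof (rule eq_matI)
    fix i j assume "i < dim_row (mon p (\<lambda>i. g $$ (i, t i)) t)"
      "j < dim_col (mon p (\<lambda>i. g $$ (i, t i)) t)"
    thus "g $$ (i,j) = mon p (\<lambda>i. g $$ (i, t i)) t $$ (i,j)"
      using uniq[of i j] by (cases "j = t i") auto
  qed (use g in auto)
  ultimately show thesis using t(2) by (intro that)
qed

lemma diag_mat_eq_mon:
  assumes "a \<in> diag_mats p"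
  shows "a = mon p (\<lambda>i. a $$ (i,i)) id" "\<And>i. i < p \<Longrightarrow> a $$ (i,i) \<noteq> 0"
  using assms by (auto simp: diag_mats_def intro!: eq_matI)

lemma mon_id_in_diag_mats: "(\<And>i. i < p \<Longrightarrow> d i \<noteq> 0) \<Longrightarrow> mon p d id \<in> diag_mats p"
  by (auto simp: diag_mats_def)

lemma diag_mats_subset_monomial_mats: "diag_mats p \<subseteq> monomial_mats p"
proof
  fix a assume a: "a \<in> diag_mats p"
  have "mon p (\<lambda>i. a $$ (i,i)) id \<in> monomial_mats p"
    by (rule mon_in_monomial_mats) (use diag_mat_eq_mon[OF a] in auto)
  thus "a \<in> monomial_mats p" using diag_mat_eq_mon(1)[OF a] by simp
qed

lemma perm_mat_eq_mon: "perm_mat p t = mon p (\<lambda>_. 1) t"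
  by (rule eq_matI) (auto simp: perm_mat_def)

lemma scalar_mat_eq_mon: "scalar_mat p c = mon p (\<lambda>_. c) id"
  by (rule eq_matI) (auto simp: scalar_mat_def)

lemma mon_mult_vec:
  assumes "t permutes {..<p}" "v \<in> carrier_vec p"
  shows "mon p d t *\<^sub>v v = vec p (\<lambda>i. d i * v $ (t i))"
proof (rule eq_vecI)
  fix i assume "i < dim_vec (vec p (\<lambda>i. d i * v $ (t i)))"
  hence i: "i < p" by simp
  have ti: "t i < p" using assms i permutes_less by auto
  have "(mon p d t *\<^sub>v v) $ i = (\<Sum>k\<in>{0..<p}. (if k = t i then d i else 0) * v $ k)"
    using i assms(2) by (simp add: scalar_prod_def)
  also have "\<dots> = (\<Sum>k\<in>{0..<p}. if k = t i then d i * v $ k else 0)"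
    by (rule sum.cong) auto
  also have "\<dots> = d i * v $ (t i)" using ti by (subst sum.delta) auto
  finally show "(mon p d t *\<^sub>v v) $ i = vec p (\<lambda>i. d i * v $ (t i)) $ i" using i by simp
qed simp

lemma matgroup_inverse_mem:
  assumes "matgroup p G" "x \<in> G" "y \<in> carrier_mat p p" "x * y = 1\<^sub>m p"
  shows "y \<in> G"
proof -
  obtain z where z: "z \<in> G" "z * x = 1\<^sub>m p" using assms by (auto simp: matgroup_def)
  have c: "x \<in> carrier_mat p p" "z \<in> carrier_mat p p" using assms z by (auto simp: matgroup_def)
  have "z = z * (x * y)" using c assms by simp
  also have "\<dots> = (z * x) * y" using c assms by (simp add: assoc_mult_mat)
  finally show ?thesis using z assms by simp
qed

text \<open>Multiplication by c permutes S, so comparing the product over S with the product over c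
  S gives c^|S| = 1; S then exhausts the |S| roots. Finiteness makes closure under products enough
  for a group.\<close>

lemma finite_subgroup_eq_roots_of_unity:
  fixes S :: "complex set"
  assumes fin: "finite S" and ne: "S \<noteq> {}" and nz: "0 \<notin> S"
    and mult: "\<And>x y. x \<in> S \<Longrightarrow> y \<in> S \<Longrightarrow> x * y \<in> S"
  shows "S = {z. z ^ card S = 1}"
proof -
  have "c ^ card S = 1" if c: "c \<in> S" for c
  proof -
    have c0: "c \<noteq> 0" using c nz by auto
    have inj: "inj_on ((*) c) S" using c0 by (auto intro: inj_onI)
    have im: "(*) c ` S = S"
      by (rule card_subset_eq[OF fin]) (use c mult inj in \<open>auto simp: card_image\<close>)
    have "\<Prod>S = (\<Prod>x\<in>S. c * x)"
      using prod.reindex[OF inj, of "\<lambda>x. x"] im by (simp add: o_def)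
    also have "\<dots> = c ^ card S * \<Prod>S" by (simp add: prod.distrib)
    finally show ?thesis using nz fin by auto
  qed
  moreover have "card S > 0" using fin ne by (simp add: card_gt_0_iff)
  ultimately show ?thesis
    by (intro card_subset_eq finite_roots_unity) (auto simp: card_roots_unity_eq)
qed

lemma extend_to_permutation:
  assumes "finite X" "inj_on f X" "X \<subseteq> S" "f ` X \<subseteq> S"
  shows "\<exists>t. t permutes S \<and> (\<forall>x\<in>X. t x = f x)"
  using assms
proof (induction X rule: finite_induct)
  case empty
  show ?case by (auto intro: exI[of _ id] permutes_id)
next
  case (insert x X)
  then obtain t where t: "t permutes S" "\<forall>y\<in>X. t y = f y" by auto
  define u where "u = Transposition.transpose (f x) (t x) \<circ> t"
  have "t x \<in> S" using insert.prems t permutes_in_image[of t S x] by auto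
  hence "u permutes S"
    unfolding u_def using t insert.prems by (intro permutes_compose permutes_swap_id) auto
  moreover have "u y = f y" if y: "y \<in> X" for y
  proof -
    have "f y \<noteq> f x" using insert.prems(1) insert.hyps(2) y by (auto simp: inj_on_def)
    moreover have "t y \<noteq> t x" using permutes_inj[OF t(1)] insert y by (auto dest: injD)
    ultimately show ?thesis using t y by (simp add: u_def)
  qed
  moreover have "u x = f x" by (simp add: u_def)
  ultimately show ?case by blast
qed

lemma permutation_through2:
  fixes i j i' j' p :: nat
  assumes "i < p" "j < p" "i' < p" "j' < p" "i \<noteq> j" "i' \<noteq> j'"
  obtains t where "t permutes {..<p}" "t i = i'" "t j = j'"
proof -
  define f where "f x = (if x = i then i' else j')" for x
  have f: "f i = i'" "f j = j'" using assms by (auto simp: f_def)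
  hence "inj_on f {i,j}" "f ` {i,j} \<subseteq> {..<p}" using assms by (auto simp: inj_on_def)
  from extend_to_permutation[OF _ this(1) _ this(2)] assms f that show thesis by auto
qed

lemma permutation_through3:
  fixes i j k i' j' k' p :: nat
  assumes "i < p" "j < p" "k < p" "i' < p" "j' < p" "k' < p"
    and "i \<noteq> j" "i \<noteq> k" "j \<noteq> k" "i' \<noteq> j'" "i' \<noteq> k'" "j' \<noteq> k'"
  obtains t where "t permutes {..<p}" "t i = i'" "t j = j'" "t k = k'"
proof -
  define f where "f x = (if x = i then i' else if x = j then j' else k')" for x
  have f: "f i = i'" "f j = j'" "f k = k'" using assms by (auto simp: f_def)
  hence "inj_on f {i,j,k}" "f ` {i,j,k} \<subseteq> {..<p}" using assms by (auto simp: inj_on_def)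
  from extend_to_permutation[OF _ this(1) _ this(2)] assms f that show thesis by auto
qed

section \<open>Groups of monomial matrices\<close>

locale monomial_group =
  fixes p :: nat and G :: "complex mat set"
  assumes matgroup: "matgroup p G" and monomial: "G \<subseteq> monomial_mats p"
begin

lemma one_mem: "mon p (\<lambda>_. 1) id \<in> G"
  using matgroup by (simp add: matgroup_def mon_one)

lemma entry_nonzero:
  assumes "mon p d t \<in> G" "i < p"
  shows "d i \<noteq> 0"
proof
  assume "d i = 0"
  hence z: "mon p d t $$ (i,j) = 0" if "j < p" for j using assms(2) that by simp
  have "mon p d t \<in> monomial_mats p" using assms(1) monomial by blast
  hence "\<exists>!j. j < p \<and> mon p d t $$ (i,j) \<noteq> 0" using assms(2) by (simp add: monomial_mats_def)
  thus False using z by blast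
qed

lemma mem_cong: "mon p d t \<in> G \<Longrightarrow> (\<And>i. i < p \<Longrightarrow> d i = e i) \<Longrightarrow> mon p e t \<in> G"
  using mon_cong[of p d e t] by simp

lemma mult_mem:
  assumes "mon p d t \<in> G" "mon p e u \<in> G" "t permutes {..<p}"
    and "\<And>i. i < p \<Longrightarrow> f i = d i * e (t i)"
  shows "mon p f (u \<circ> t) \<in> G"
proof -
  have "mon p d t * mon p e u \<in> G" using matgroup assms by (auto simp: matgroup_def)
  thus ?thesis unfolding mon_mult[OF assms(3)] by (rule mem_cong) (simp add: assms)
qed

lemma inverse_mem:
  assumes "mon p d t \<in> G" "t permutes {..<p}"
  shows "mon p (\<lambda>i. inverse (d (pinv t i))) (pinv t) \<in> G"
  by (rule matgroup_inverse_mem[OF matgroup assms(1)])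
    (use mon_inverse(1)[OF assms(2)] entry_nonzero[OF assms(1)] in auto)

lemma diag_mult_mem:
  assumes "mon p a id \<in> G" "mon p d t \<in> G" "\<And>i. i < p \<Longrightarrow> f i = a i * d i"
  shows "mon p f t \<in> G"
  using mult_mem[OF assms(1,2) permutes_id, of f] assms(3) by simp

lemma diag_inverse_mem:
  assumes "mon p a id \<in> G" "\<And>i. i < p \<Longrightarrow> f i = inverse (a i)"
  shows "mon p f id \<in> G"
  using inverse_mem[OF assms(1) permutes_id] assms(2) by (auto intro: mem_cong)

lemma diag_divide_mem:
  assumes "mon p a id \<in> G" "mon p b id \<in> G" "\<And>i. i < p \<Longrightarrow> f i = a i / b i"
  shows "mon p f id \<in> G"
  by (rule diag_mult_mem[OF assms(1) diag_inverse_mem[OF assms(2) refl]])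
    (simp add: assms(3) divide_inverse)

lemma diag_power_mem:
  assumes "mon p a id \<in> G" "\<And>i. i < p \<Longrightarrow> f i = a i ^ n"
  shows "mon p f id \<in> G"
proof -
  have "mon p (\<lambda>i. a i ^ n) id \<in> G" for n
  proof (induction n)
    case 0
    show ?case using one_mem by (simp add: id_def)
  next
    case (Suc n)
    show ?case by (rule diag_mult_mem[OF assms(1) Suc]) simp
  qed
  from mem_cong[OF this] show ?thesis using assms(2) by auto
qed

lemma quotient_mem:
  assumes "mon p d t \<in> G" "mon p e t \<in> G" "t permutes {..<p}"
    and "\<And>i. i < p \<Longrightarrow> f i = d i / e i"
  shows "mon p f id \<in> G"
proof -
  have "mon p f (pinv t \<circ> t) \<in> G"
    by (rule mult_mem[OF assms(1) inverse_mem[OF assms(2,3)] assms(3)])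
      (simp add: assms(4) permutes_inverses(2)[OF assms(3)] divide_inverse)
  thus ?thesis using permutes_inv_o[OF assms(3)] by simp
qed

text \<open>Conjugating a by a lift of t permutes the entries of a; the coefficients d cancel, so
  every lift acts alike.\<close>

lemma diag_conj_mem:
  assumes "mon p d t \<in> G" "mon p a id \<in> G" "t permutes {..<p}"
  shows "mon p (a \<circ> t) id \<in> G"
proof -
  have "mon p (\<lambda>i. d i * a (t i)) (id \<circ> t) \<in> G"
    by (rule mult_mem[OF assms]) simp
  thus ?thesis
    by (intro quotient_mem[OF _ assms(1,3)]) (use entry_nonzero[OF assms(1)] in auto)
qed

lemma perm_part_eq:
  "perm_part p G = {t. t permutes {..<p} \<and> (\<exists>d. mon p d t \<in> G)}"
proof (rule equalityI; rule subsetI)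
  fix t assume "t \<in> perm_part p G"
  then obtain g where t: "t permutes {..<p}" and g: "g \<in> G"
    "\<And>i j. i < p \<Longrightarrow> j < p \<Longrightarrow> g $$ (i,j) \<noteq> 0 \<longleftrightarrow> j = t i" by (auto simp: perm_part_def)
  obtain d u where u: "u permutes {..<p}" "\<And>i. i < p \<Longrightarrow> d i \<noteq> 0" "g = mon p d u"
    using monomial_matsE[of g p] g(1) monomial by (metis subsetD)
  have "t i = u i" for i
  proof (cases "i < p")
    case True
    hence "t i < p" using permutes_less[OF t] by blast
    from g(2)[OF True this] True this show ?thesis using u by (auto split: if_splits)
  next
    case False
    thus ?thesis using permutes_not_in[OF t, of i] permutes_not_in[OF u(1), of i] by simp
  qed
  hence "t = u" by auto
  thus "t \<in> {t. t permutes {..<p} \<and> (\<exists>d. mon p d t \<in> G)}" using u g(1) by auto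
next
  fix t assume "t \<in> {t. t permutes {..<p} \<and> (\<exists>d. mon p d t \<in> G)}"
  then obtain d where t: "t permutes {..<p}" and d: "mon p d t \<in> G" by auto
  have "\<And>i j. i < p \<Longrightarrow> j < p \<Longrightarrow> mon p d t $$ (i,j) \<noteq> 0 \<longleftrightarrow> j = t i"
    using entry_nonzero[OF d] by auto
  thus "t \<in> perm_part p G" using t d unfolding perm_part_def by blast
qed

lemma mem_monE:
  assumes "g \<in> G"
  obtains d t where "t permutes {..<p}" "g = mon p d t"
  using monomial_matsE[of g p] assms monomial by (metis subsetD)

end

section \<open>Permutation-invariant diagonal groups and their ratio group\<close>

definition diag_pair :: "nat \<Rightarrow> nat \<Rightarrow> complex \<Rightarrow> nat \<Rightarrow> complex" where
  "diag_pair i j x k = (if k = i then x else if k = j then inverse x else 1)"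

locale sym_diag_group = monomial_group p A for p A +
  assumes fin: "finite A" and diag: "A \<subseteq> diag_mats p"
    and sym: "\<And>t a. t permutes {..<p} \<Longrightarrow> mon p a id \<in> A \<Longrightarrow> mon p (a \<circ> t) id \<in> A"
begin

lemma mem_diagE:
  assumes "g \<in> A"
  obtains a where "g = mon p a id"
  using diag_mat_eq_mon[of g p] assms diag by auto

text \<open>The positions 0 and 1 are immaterial by double transitivity. The set contains all
  quotients a_i/a_j of entries of elements of A and turns out to be a full group of roots of
  unity.\<close>

definition ratios :: "complex set" where
  "ratios = {x. mon p (diag_pair 0 1 x) id \<in> A}"

text \<open>Dividing a by its image under the transposition (i j) cancels every coordinate except i
  and j.\<close>

lemma diag_pair_ratio_mem:
  assumes "mon p a id \<in> A" "i < p" "j < p" "i \<noteq> j"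
  shows "mon p (diag_pair i j (a i / a j)) id \<in> A"
proof -
  have "mon p (a \<circ> Transposition.transpose i j) id \<in> A"
    using assms by (intro sym permutes_swap_id) auto
  from diag_divide_mem[OF assms(1) this refl] show ?thesis
    by (rule mem_cong) (use assms(4) entry_nonzero[OF assms(1)] in
      \<open>simp add: diag_pair_def Transposition.transpose_def\<close>)
qed

lemma diag_pair_mem_iff_ratio:
  assumes "i < p" "j < p" "i \<noteq> j"
  shows "mon p (diag_pair i j x) id \<in> A \<longleftrightarrow> x \<in> ratios"
proof -
  have *: "mon p (diag_pair k l x) id \<in> A"
    if "mon p (diag_pair i j x) id \<in> A" "i < p" "j < p" "i \<noteq> j" "k < p" "l < p" "k \<noteq> l" for i j k l
  proof -
    from that obtain t where t: "t permutes {..<p}" "t k = i" "t l = j"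
      using permutation_through2 by metis
    have "t m = i \<longleftrightarrow> m = k" "t m = j \<longleftrightarrow> m = l" for m
      using injD[OF permutes_inj[OF t(1)]] t(2,3) by blast+
    hence "diag_pair i j x \<circ> t = diag_pair k l x" by (simp add: fun_eq_iff diag_pair_def)
    thus ?thesis using sym[OF t(1) that(1)] by simp
  qed
  have "0 < p" "1 < p" using assms by auto
  thus ?thesis using *[of i j 0 1] *[of 0 1 i j] assms by (auto simp: ratios_def)
qed

lemma ratio_mem:
  assumes "mon p a id \<in> A" "i < p" "j < p" "2 \<le> p"
  shows "a i / a j \<in> ratios"
proof (cases "i = j")
  case True
  have "mon p (diag_pair 0 1 1) id \<in> A" using one_mem by (rule mem_cong) (simp add: diag_pair_def)
  thus ?thesis using True entry_nonzero[OF assms(1,2)] by (simp add: ratios_def)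
next
  case False
  thus ?thesis using diag_pair_ratio_mem[OF assms(1-3) False] diag_pair_mem_iff_ratio assms by blast
qed

context
  assumes p2: "2 \<le> p"
begin

lemma one_ratio: "1 \<in> ratios"
  using ratio_mem[OF one_mem, of 0 0] p2 by simp

lemma ratio_nonzero: "x \<in> ratios \<Longrightarrow> x \<noteq> 0"
  unfolding ratios_def using entry_nonzero[of "diag_pair 0 1 x" id 0] p2 by (auto simp: diag_pair_def)

lemma ratio_mult: "x \<in> ratios \<Longrightarrow> y \<in> ratios \<Longrightarrow> x * y \<in> ratios"
  unfolding ratios_def by (auto intro: diag_mult_mem simp: diag_pair_def)

lemma finite_ratios: "finite ratios"
proof (rule finite_imageD)
  show "finite ((\<lambda>x. mon p (diag_pair 0 1 x) id) ` ratios)"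
    by (rule finite_subset[OF _ fin]) (auto simp: ratios_def)
  show "inj_on (\<lambda>x. mon p (diag_pair 0 1 x) id) ratios"
  proof (rule inj_onI)
    fix x y assume "mon p (diag_pair 0 1 x) id = mon p (diag_pair 0 1 y) id"
    hence "mon p (diag_pair 0 1 x) id $$ (0,0) = mon p (diag_pair 0 1 y) id $$ (0,0)" by simp
    thus "x = y" using p2 by (simp add: diag_pair_def)
  qed
qed

lemma ratios_eq_roots: "ratios = {z. z ^ card ratios = 1}" and card_ratios_pos: "0 < card ratios"
proof -
  show "ratios = {z. z ^ card ratios = 1}"
    using one_ratio ratio_nonzero
    by (intro finite_subgroup_eq_roots_of_unity finite_ratios ratio_mult) auto
  show "0 < card ratios" using one_ratio finite_ratios by (auto simp: card_gt_0_iff)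
qed

text \<open>The pairs \<open>diag_pair k 0 (b k)\<close> fix coordinates 1, ..., p-1 independently;
  coordinate 0 collects the inverses, and the determinant condition says that this is the required
  value.\<close>

lemma ratio_prod_eq_1_mem:
  assumes b: "\<And>i. i < p \<Longrightarrow> b i \<in> ratios" and prod: "(\<Prod>i<p. b i) = 1"
  shows "mon p b id \<in> A"
proof -
  \<comment> \<open>Partial product of the pairs with 1 <= k < n; for n = 0 and n = 1 it is the
    identity.\<close>
  have "mon p (\<lambda>i. if i = 0 then inverse (\<Prod>k\<in>{1..<n}. b k) else if i < n then b i else 1) id \<in> A"
    if "n \<le> p" for n
    using that
  proof (induction n)
    case 0
    show ?case using one_mem by (rule mem_cong) simp
  next
    case (Suc n)
    show ?case
    proof (cases "n = 0")
      case True
      show ?thesis using one_mem by (rule mem_cong) (simp add: True)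
    next
      case False
      have "mon p (diag_pair n 0 (b n)) id \<in> A" using Suc False b diag_pair_mem_iff_ratio by auto
      from diag_mult_mem[OF this Suc.IH] show ?thesis
        using False Suc.prems by (auto simp: diag_pair_def prod.op_ivl_Suc less_Suc_eq)
    qed
  qed
  from this[of p] have 1: "mon p (\<lambda>i. if i = 0 then inverse (\<Prod>k\<in>{1..<p}. b k) else if i < p then b i else 1) id \<in> A"
    by simp
  have "{..<p} = insert 0 {1..<p}" using p2 by auto
  hence "b 0 * (\<Prod>k\<in>{1..<p}. b k) = 1" using prod by simp
  hence "b 0 = inverse (\<Prod>k\<in>{1..<p}. b k)"
    by (metis inverse_unique mult.commute)
  with 1 show ?thesis by (auto elim!: mem_cong)
qed

text \<open>The product of e(t i)/e(i) over all i is 1 because t merely reorders the numerators.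
  Hence permuting such a vector e changes it only by an element of A.\<close>

lemma ratio_vector_conj_mem:
  assumes e: "\<And>i. i < p \<Longrightarrow> e i \<noteq> 0" "\<And>i j. i < p \<Longrightarrow> j < p \<Longrightarrow> e i / e j \<in> ratios"
    and t: "t permutes {..<p}"
  shows "mon p (\<lambda>i. e (t i) / e i) id \<in> A"
proof (rule ratio_prod_eq_1_mem)
  show "i < p \<Longrightarrow> e (t i) / e i \<in> ratios" for i using e permutes_less[OF t] by auto
  have "(\<Prod>i<p. e (t i)) = (\<Prod>i<p. e i)"
    using prod.permute[OF t, of e] by (simp add: o_def)
  moreover have "(\<Prod>i<p. e i) \<noteq> 0" using e by auto
  ultimately show "(\<Prod>i<p. e (t i) / e i) = 1" by (simp add: prod_dividef)
qed

text \<open>The i-th entry is the product over k of e_i/e_k, and the product of all entries is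
  1.\<close>

lemma ratio_vector_power_mem:
  assumes e: "\<And>i. i < p \<Longrightarrow> e i \<noteq> 0" "\<And>i j. i < p \<Longrightarrow> j < p \<Longrightarrow> e i / e j \<in> ratios"
  shows "mon p (\<lambda>i. e i ^ p / (\<Prod>k<p. e k)) id \<in> A"
proof (rule ratio_prod_eq_1_mem)
  fix i assume i: "i < p"
  have "(\<Prod>k\<in>S. e i / e k) \<in> ratios" if "S \<subseteq> {..<p}" for S
    using finite_subset[OF that finite_lessThan] that
    by (induction S rule: finite_induct) (simp_all add: one_ratio ratio_mult e(2)[OF i] del: times_divide_eq_left times_divide_eq_right)
  from this[of "{..<p}"] show "e i ^ p / (\<Prod>k<p. e k) \<in> ratios" by (simp add: prod_dividef)
next
  have "(\<Prod>i<p. e i) \<noteq> 0" using e by auto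
  thus "(\<Prod>i<p. e i ^ p / (\<Prod>k<p. e k)) = 1" by (simp add: prod_dividef prod_power_distrib)
qed

end

end

section \<open>The extensions of a diagonal group by the symmetric group\<close>

text \<open>In general not a character: two odd permutations leave a surplus w^2. Having that scalar
  in A is what closes \<open>ext_group\<close> under products.\<close>

definition twist :: "complex \<Rightarrow> (nat \<Rightarrow> nat) \<Rightarrow> complex" where
  "twist w t = (if evenperm t then 1 else w)"

lemma twist_nonzero: "w \<noteq> 0 \<Longrightarrow> twist w t \<noteq> 0"
  by (simp add: twist_def)

lemma permutes_lessThan_permutation: "t permutes {..<(p::nat)} \<Longrightarrow> permutation t"
  using permutes_imp_permutation[of "{..<p}" t] by simp

lemma twist_comp:
  assumes "t permutes {..<(p::nat)}" "u permutes {..<(p::nat)}" "w \<noteq> 0"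
  shows "twist w t * twist w u / twist w (u \<circ> t) = (if evenperm t \<or> evenperm u then 1 else w\<^sup>2)"
  using assms evenperm_comp[of u t] permutes_lessThan_permutation
  by (auto simp: twist_def power2_eq_square)

lemma twist_inv:
  assumes "t permutes {..<(p::nat)}"
  shows "twist w (pinv t) = twist w t"
  using evenperm_inv[OF permutes_lessThan_permutation[OF assms]] by (simp add: twist_def)

context monomial_group
begin

text \<open>Each transposition contributes a factor w; whenever an odd permutation becomes even, the
  surplus w^2 lies in G and is divided out.\<close>

lemma twisted_transpositions_imp_perms:
  assumes w: "w \<noteq> 0" and w2: "mon p (\<lambda>_. w\<^sup>2) id \<in> G"
    and tr: "\<And>a b. a < p \<Longrightarrow> b < p \<Longrightarrow> a \<noteq> b \<Longrightarrow> mon p (\<lambda>_. w) (Transposition.transpose a b) \<in> G"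
    and t: "t permutes {..<p}"
  shows "mon p (\<lambda>_. twist w t) t \<in> G"
  using t finite_lessThan
proof (induction t rule: permutes_induct)
  case id
  show ?case using one_mem by (simp add: twist_def id_def)
next
  case (swap a b t)
  let ?u = "Transposition.transpose a b"
  have u: "mon p (\<lambda>_. w) ?u \<in> G" using tr swap by simp
  have up: "?u permutes {..<p}" using swap by (intro permutes_swap_id)
  have tw: "twist w ?u = w" using swap by (simp add: twist_def evenperm_swap)
  have eq: "twist w t * w = (if evenperm t then 1 else w\<^sup>2) * twist w (?u \<circ> t)"
    using twist_comp[OF swap.hyps(4) up w] twist_nonzero[OF w, of "?u \<circ> t"] swap
    by (simp add: tw evenperm_swap divide_eq_eq split: if_splits)
  have 1: "mon p (\<lambda>_. twist w t * w) (?u \<circ> t) \<in> G"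
    by (rule mult_mem[OF swap.IH u swap.hyps(4)]) simp
  have 2: "mon p (\<lambda>_. inverse (if evenperm t then 1 else w\<^sup>2)) id \<in> G"
    by (rule diag_inverse_mem[of "\<lambda>_. if evenperm t then 1 else w\<^sup>2"]) (use w2 one_mem in auto)
  show ?case
    by (rule diag_mult_mem[OF 2 1]) (use w in \<open>auto simp: eq simp del: comp_apply o_apply\<close>)
qed

text \<open>Conjugating (a b) by (b b+1) gives (a b+1) with coefficient w^3, which is reduced to w
  by the scalar w^2 in G.\<close>

lemma adjacent_transpositions_imp_transpositions:
  assumes w: "w \<noteq> 0" and w2: "mon p (\<lambda>_. w\<^sup>2) id \<in> G"
    and adj: "\<And>k. Suc k < p \<Longrightarrow> mon p (\<lambda>_. w) (Transposition.transpose k (Suc k)) \<in> G"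
    and ab: "a < p" "b < p" "a \<noteq> b"
  shows "mon p (\<lambda>_. w) (Transposition.transpose a b) \<in> G"
proof -
  have *: "mon p (\<lambda>_. w) (Transposition.transpose a (Suc (a + n))) \<in> G" if "Suc (a + n) < p" for a n
    using that
  proof (induction n)
    case 0
    thus ?case using adj[of a] by simp
  next
    case (Suc n)
    define b where "b = Suc (a + n)"
    have b: "Suc b < p" "a < b" using Suc by (auto simp: b_def)
    let ?u = "Transposition.transpose b (Suc b)" and ?t = "Transposition.transpose a b"
    have up: "?u permutes {..<p}" and tp: "?t permutes {..<p}"
      using b by (auto intro!: permutes_swap_id)
    have u: "mon p (\<lambda>_. w) ?u \<in> G" using adj b by simp
    have t: "mon p (\<lambda>_. w) ?t \<in> G" using Suc b by (simp add: b_def)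
    have "mon p (\<lambda>_. w * w) (?t \<circ> ?u) \<in> G" by (rule mult_mem[OF u t up]) simp
    from mult_mem[OF this u permutes_compose[OF up tp], of "\<lambda>_. w * w * w"]
    have 1: "mon p (\<lambda>_. w * w * w) (?u \<circ> (?t \<circ> ?u)) \<in> G" by simp
    have "?u \<circ> (?t \<circ> ?u) = Transposition.transpose a (Suc b)"
      using transpose_comp_triple[of "Suc b" a b] b
      by (simp add: transpose_commute comp_assoc)
    moreover have "mon p (\<lambda>_. w) (?u \<circ> (?t \<circ> ?u)) \<in> G"
      by (rule diag_mult_mem[OF diag_inverse_mem[OF w2 refl] 1])
        (use w in \<open>simp add: power2_eq_square field_simps\<close>)
    ultimately show ?case by (simp add: b_def)
  qed
  show ?thesis
  proof (cases "a < b")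
    case True
    thus ?thesis using *[of a "b - a - 1"] ab by simp
  next
    case False
    thus ?thesis using *[of b "a - b - 1"] ab by (simp add: transpose_commute)
  qed
qed

end

definition shift :: "nat \<Rightarrow> nat \<Rightarrow> nat" where
  "shift p i = (if i < p then (i + 1) mod p else i)"

lemma shift_permutes: "0 < p \<Longrightarrow> shift p permutes {..<p}"
proof (rule inj_imp_permutes)
  show "inj_on (shift p) {..<p}"
    by (rule inj_onI) (auto simp: shift_def mod_Suc split: if_splits)
qed (auto simp: shift_def)

lemma funpow_shift: "0 < p \<Longrightarrow> (shift p ^^ k) i = (if i < p then (i + k) mod p else i)"
  by (induction k) (auto simp: shift_def mod_simps)

text \<open>The p-th power of the cycle is the identity, so its sign is a p-th root of 1 in {1, -1};
  p is odd.\<close>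

lemma evenperm_shift:
  assumes "odd p"
  shows "evenperm (shift p)"
proof -
  have p0: "0 < p" using assms by (cases p) auto
  have perm: "permutation (shift p)"
    using shift_permutes[OF p0] by (rule permutes_lessThan_permutation)
  have "permutation (shift p ^^ k) \<and> sign (shift p ^^ k) = sign (shift p) ^ k" for k
    by (induction k) (simp_all add: perm permutation_compose sign_compose del: comp_apply o_apply)
  moreover have "shift p ^^ p = id"
    using p0 by (auto simp: fun_eq_iff funpow_shift)
  ultimately have "sign (shift p) ^ p = 1" by (metis sign_id)
  thus ?thesis using assms by (cases "evenperm (shift p)") (auto simp: sign_def)
qed

lemma s_mat_eq_mon: "s_mat p = mon p (\<lambda>_. 1) (shift p)"
  by (simp add: s_mat_def perm_mat_eq_mon shift_def[abs_def])

lemma r_mat_eq_mon: "r_mat p = mon p (\<lambda>_. 1) (Transposition.transpose 0 1)"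
  by (simp add: r_mat_def perm_mat_eq_mon)

lemma r_mat_scalar_eq_mon:
  assumes "2 \<le> p"
  shows "r_mat p * scalar_mat p w = mon p (\<lambda>_. w) (Transposition.transpose 0 1)"
proof -
  have "Transposition.transpose 0 1 permutes {..<p}" using assms by (intro permutes_swap_id) auto
  thus ?thesis by (simp add: r_mat_eq_mon scalar_mat_eq_mon mon_mult)
qed

text \<open>The group \<open>H\<close> makes the intersection range over a nonempty family. An
  inverse found in \<open>H\<close> lies in every other member, since matrix inverses are
  unique.\<close>

lemma matgroup_gen_group:
  assumes "matgroup p H" "S \<subseteq> H"
  shows "matgroup p (gen_group p S)"
proof -
  let ?F = "{H. matgroup p H \<and> S \<subseteq> H}"
  have H: "H \<in> ?F" using assms by simp
  have inv: "\<exists>y\<in>gen_group p S. x * y = 1\<^sub>m p \<and> y * x = 1\<^sub>m p" if x: "x \<in> gen_group p S" for x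
  proof -
    have "x \<in> H" using x H by (auto simp: gen_group_def)
    then obtain y where y: "y \<in> H" "x * y = 1\<^sub>m p" "y * x = 1\<^sub>m p"
      using assms by (auto simp: matgroup_def)
    have "y \<in> carrier_mat p p" using y assms by (auto simp: matgroup_def)
    have "y \<in> K" if K: "K \<in> ?F" for K
    proof (rule matgroup_inverse_mem[OF _ _ \<open>y \<in> carrier_mat p p\<close> y(2)])
      show "matgroup p K" using K by simp
      show "x \<in> K" using x K unfolding gen_group_def by (rule InterD)
    qed
    hence "y \<in> gen_group p S" unfolding gen_group_def by (rule InterI)
    thus ?thesis using y by blast
  qed
  show ?thesis unfolding matgroup_def
  proof (intro conjI ballI)
    show "gen_group p S \<subseteq> carrier_mat p p" using H by (auto simp: gen_group_def matgroup_def)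
  qed (use inv in \<open>auto simp: gen_group_def matgroup_def\<close>)
qed

lemma gen_group_superset: "S \<subseteq> gen_group p S"
  by (auto simp: gen_group_def)

lemma gen_group_least: "matgroup p H \<Longrightarrow> S \<subseteq> H \<Longrightarrow> gen_group p S \<subseteq> H"
  by (auto simp: gen_group_def)

section \<open>The extension of A by Sym(p) with twist w\<close>

definition ext_group :: "nat \<Rightarrow> complex mat set \<Rightarrow> complex \<Rightarrow> complex mat set" where
  "ext_group p A w = {mon p (\<lambda>i. a i * twist w t) t | a t. t permutes {..<p} \<and> mon p a id \<in> A}"

locale twisted_ext = sym_diag_group p A for p A +
  fixes w :: complex
  assumes w2_mem: "mon p (\<lambda>_. w\<^sup>2) id \<in> A" and p_ge_2: "2 \<le> p"
begin

lemma w_nonzero: "w \<noteq> 0"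
  using entry_nonzero[OF w2_mem, of 0] p_ge_2 by auto

text \<open>The permutation can be read off from the matrix, so the factorization into a diagonal
  element and a twisted permutation is unique.\<close>

lemma ext_mem_iff:
  assumes t: "t permutes {..<p}"
  shows "mon p d t \<in> ext_group p A w \<longleftrightarrow> mon p (\<lambda>i. d i / twist w t) id \<in> A"
proof
  assume "mon p d t \<in> ext_group p A w"
  then obtain a u where u: "u permutes {..<p}" "mon p a id \<in> A"
    and eq: "mon p (\<lambda>i. a i * twist w u) u = mon p d t" by (auto simp: ext_group_def)
  have nz: "a i * twist w u \<noteq> 0" if "i < p" for i
    using entry_nonzero[OF u(2) that] twist_nonzero[OF w_nonzero] by simp
  have "u = t" using mon_eqD(1)[OF eq u(1) t nz] .
  moreover have "a i * twist w u = d i" if "i < p" for i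
    using mon_eqD(2)[OF eq u(1) t nz that] .
  ultimately show "mon p (\<lambda>i. d i / twist w t) id \<in> A"
    using u(2) twist_nonzero[OF w_nonzero, of t] by (auto elim!: mem_cong simp: eq_divide_eq)
next
  assume "mon p (\<lambda>i. d i / twist w t) id \<in> A"
  hence "mon p (\<lambda>i. d i / twist w t * twist w t) t \<in> ext_group p A w"
    using t unfolding ext_group_def by (intro CollectI exI[of _ "\<lambda>i. d i / twist w t"] exI[of _ t]) simp
  thus "mon p d t \<in> ext_group p A w" using twist_nonzero[OF w_nonzero, of t] by simp
qed

lemma ext_diag_mem_iff: "mon p d id \<in> ext_group p A w \<longleftrightarrow> mon p d id \<in> A"
  using ext_mem_iff[of id] by (simp add: twist_def permutes_id)

lemma ext_memE:
  assumes "g \<in> ext_group p A w"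
  obtains d t where "g = mon p d t" "t permutes {..<p}" "mon p (\<lambda>i. d i / twist w t) id \<in> A"
proof -
  obtain a t where g: "g = mon p (\<lambda>i. a i * twist w t) t" "t permutes {..<p}"
    using assms by (auto simp: ext_group_def)
  moreover have "mon p (\<lambda>i. a i * twist w t / twist w t) id \<in> A"
    using assms ext_mem_iff[OF g(2)] g(1) by simp
  ultimately show thesis using that by blast
qed

lemma ext_monomial: "ext_group p A w \<subseteq> monomial_mats p"
proof
  fix g assume "g \<in> ext_group p A w"
  then obtain a t where "t permutes {..<p}" "mon p a id \<in> A" "g = mon p (\<lambda>i. a i * twist w t) t"
    by (auto simp: ext_group_def)
  thus "g \<in> monomial_mats p"
    using entry_nonzero twist_nonzero[OF w_nonzero] by (auto intro!: mon_in_monomial_mats)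
qed

lemma ext_matgroup: "matgroup p (ext_group p A w)"
  unfolding matgroup_def
proof (intro conjI ballI)
  show "ext_group p A w \<subseteq> carrier_mat p p" by (auto simp: ext_group_def)
  show "1\<^sub>m p \<in> ext_group p A w"
    unfolding mon_one[symmetric] ext_diag_mem_iff by (rule one_mem)
next
  fix x y assume "x \<in> ext_group p A w" "y \<in> ext_group p A w"
  then obtain d t e u where x: "x = mon p d t" "t permutes {..<p}" "mon p (\<lambda>i. d i / twist w t) id \<in> A"
    and y: "y = mon p e u" "u permutes {..<p}" "mon p (\<lambda>i. e i / twist w u) id \<in> A"
    by (metis ext_memE)
  have "mon p (\<lambda>_. twist w t * twist w u / twist w (u \<circ> t)) id \<in> A"
    unfolding twist_comp[OF x(2) y(2) w_nonzero] using w2_mem one_mem by auto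
  from diag_mult_mem[OF this diag_mult_mem[OF x(3) sym[OF x(2) y(3)] refl]]
  have "mon p (\<lambda>i. d i * e (t i) / twist w (u \<circ> t)) id \<in> A"
    using twist_nonzero[OF w_nonzero] by simp
  thus "x * y \<in> ext_group p A w"
    unfolding x y mon_mult[OF x(2)] ext_mem_iff[OF permutes_compose[OF x(2) y(2)]] .
next
  fix x assume x: "x \<in> ext_group p A w"
  then obtain d t where d: "x = mon p d t" "t permutes {..<p}" "mon p (\<lambda>i. d i / twist w t) id \<in> A"
    by (rule ext_memE)
  have it: "pinv t permutes {..<p}" using d(2) by (rule permutes_inv)
  have nz: "d i \<noteq> 0" if "i < p" for i using entry_nonzero[OF d(3) that] by auto
  let ?y = "mon p (\<lambda>i. inverse (d (pinv t i))) (pinv t)"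
  have "mon p (\<lambda>_. (twist w t)\<^sup>2) id \<in> A" using w2_mem one_mem by (auto simp: twist_def)
  from diag_inverse_mem[OF diag_mult_mem[OF this sym[OF it d(3)] refl]]
  have "mon p (\<lambda>i. inverse (d (pinv t i)) / twist w (pinv t)) id \<in> A"
    by (simp add: twist_inv[OF d(2)] field_simps power2_eq_square)
  hence "?y \<in> ext_group p A w" unfolding ext_mem_iff[OF it] .
  thus "\<exists>y\<in>ext_group p A w. x * y = 1\<^sub>m p \<and> y * x = 1\<^sub>m p"
    using mon_inverse[of t p d, OF d(2) nz] d(1) by blast
qed

sublocale ext: monomial_group p "ext_group p A w"
  by unfold_locales (rule ext_matgroup ext_monomial)+

lemma ext_finite: "finite (ext_group p A w)"
proof (rule finite_subset)
  show "finite ((\<lambda>(x, t). x * mon p (\<lambda>_. twist w t) t) ` (A \<times> {t. t permutes {..<p}}))"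
    using fin finite_permutations[of "{..<p}"] by auto
  show "ext_group p A w \<subseteq> (\<lambda>(x, t). x * mon p (\<lambda>_. twist w t) t) ` (A \<times> {t. t permutes {..<p}})"
  proof
    fix g assume "g \<in> ext_group p A w"
    then obtain a t where a: "t permutes {..<p}" "mon p a id \<in> A" "g = mon p (\<lambda>i. a i * twist w t) t"
      by (auto simp: ext_group_def)
    have "g = mon p a id * mon p (\<lambda>_. twist w t) t"
      by (simp add: a mon_mult[OF permutes_id])
    thus "g \<in> (\<lambda>(x, t). x * mon p (\<lambda>_. twist w t) t) ` (A \<times> {t. t permutes {..<p}})"
      using a by auto
  qed
qed

lemma twist_perm_mem: "t permutes {..<p} \<Longrightarrow> mon p (\<lambda>_. twist w t) t \<in> ext_group p A w"
  using one_mem twist_nonzero[OF w_nonzero] by (simp add: ext_mem_iff)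

lemma ext_perm_part: "perm_part p (ext_group p A w) = Sym p"
  unfolding ext.perm_part_eq Sym_def using twist_perm_mem by auto

lemma ext_subset:
  assumes "monomial_group p H" "A \<subseteq> H" "\<And>t. t permutes {..<p} \<Longrightarrow> mon p (\<lambda>_. twist w t) t \<in> H"
  shows "ext_group p A w \<subseteq> H"
proof
  interpret H: monomial_group p H by fact
  fix g assume "g \<in> ext_group p A w"
  then obtain a t where a: "t permutes {..<p}" "mon p a id \<in> A" "g = mon p (\<lambda>i. a i * twist w t) t"
    by (auto simp: ext_group_def)
  have "mon p a id \<in> H" using a(2) assms(2) by blast
  from H.diag_mult_mem[OF this assms(3)[OF a(1)]] show "g \<in> H" by (simp add: a(3))
qed

text \<open>For odd p the cycle is even, so s itself is a twisted permutation. Conversely,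
  conjugating the second generator repeatedly by s yields all adjacent transpositions with
  coefficient w, and these give every twisted permutation.\<close>

lemma gen_group_eq_ext:
  assumes "odd p"
  shows "gen_group p ({s_mat p, r_mat p * scalar_mat p w} \<union> A) = ext_group p A w"
    (is "gen_group p ?S = _")
proof (rule equalityI)
  have p0: "0 < p" using p_ge_2 by simp
  let ?r = "Transposition.transpose 0 (Suc 0)"
  have r: "?r permutes {..<p}" using p_ge_2 by (intro permutes_swap_id) auto
  have s: "shift p permutes {..<p}" using shift_permutes[OF p0] .
  have "s_mat p \<in> ext_group p A w"
    using twist_perm_mem[OF s] evenperm_shift[OF assms] by (simp add: s_mat_eq_mon twist_def)
  moreover have "r_mat p * scalar_mat p w \<in> ext_group p A w"
    using twist_perm_mem[OF r] by (simp add: r_mat_scalar_eq_mon[OF p_ge_2] twist_def evenperm_swap)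
  moreover have "A \<subseteq> ext_group p A w"
    using ext_diag_mem_iff mem_diagE by blast
  ultimately have S: "?S \<subseteq> ext_group p A w" by auto
  show sub: "gen_group p ?S \<subseteq> ext_group p A w"
    by (rule gen_group_least[OF ext_matgroup S])
  interpret H: monomial_group p "gen_group p ?S"
    using matgroup_gen_group[OF ext_matgroup S] sub ext_monomial by unfold_locales auto
  have AH: "A \<subseteq> gen_group p ?S" using gen_group_superset by blast
  have sH: "mon p (\<lambda>_. 1) (shift p) \<in> gen_group p ?S"
    using gen_group_superset[of ?S p] by (simp add: s_mat_eq_mon)
  have rH: "mon p (\<lambda>_. w) ?r \<in> gen_group p ?S"
    using gen_group_superset[of ?S p] by (simp add: r_mat_scalar_eq_mon[OF p_ge_2])
  have adj: "mon p (\<lambda>_. w) (Transposition.transpose k (Suc k)) \<in> gen_group p ?S" if "Suc k < p" for k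
    using that
  proof (induction k)
    case 0
    show ?case using rH .
  next
    case (Suc k)
    let ?t = "Transposition.transpose k (Suc k)"
    have t: "?t permutes {..<p}" using Suc by (intro permutes_swap_id) auto
    have ist: "pinv (shift p) permutes {..<p}" using s by (rule permutes_inv)
    have "mon p (\<lambda>_. w) ?t \<in> gen_group p ?S" using Suc by simp
    from H.mult_mem[OF H.inverse_mem[OF sH s] this ist, of "\<lambda>_. w"]
    have "mon p (\<lambda>_. w) (?t \<circ> pinv (shift p)) \<in> gen_group p ?S" by simp
    from H.mult_mem[OF this sH permutes_compose[OF ist t], of "\<lambda>_. w"]
    have "mon p (\<lambda>_. w) (shift p \<circ> (?t \<circ> pinv (shift p))) \<in> gen_group p ?S" by simp
    \<comment> \<open>Conjugation relabels the two points by \<open>shift p\<close>; since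
      \<open>Suc (Suc k) < p\<close>, nothing wraps around.\<close>
    moreover have "shift p \<circ> (?t \<circ> pinv (shift p)) = Transposition.transpose (Suc k) (Suc (Suc k))"
    proof
      fix i
      have "Transposition.transpose (shift p k) (shift p (Suc k)) i
          = shift p (?t (pinv (shift p) i))"
        using transpose_apply_commute[OF permutes_bij[OF s], of "shift p k" "shift p (Suc k)" "pinv (shift p) i"]
          permutes_inverses[OF s] by simp
      thus "(shift p \<circ> (?t \<circ> pinv (shift p))) i = Transposition.transpose (Suc k) (Suc (Suc k)) i"
        using Suc.prems by (simp add: shift_def)
    qed
    ultimately show ?case by simp
  qed
  have w2H: "mon p (\<lambda>_. w\<^sup>2) id \<in> gen_group p ?S" using w2_mem AH by auto
  show "ext_group p A w \<subseteq> gen_group p ?S"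
  proof (rule ext_subset[OF H.monomial_group_axioms AH])
    fix t :: "nat \<Rightarrow> nat" assume "t permutes {..<p}"
    thus "mon p (\<lambda>_. twist w t) t \<in> gen_group p ?S"
      using H.adjacent_transpositions_imp_transpositions[OF w_nonzero w2H adj]
      by (intro H.twisted_transpositions_imp_perms[OF w_nonzero w2H]) blast+
  qed
qed

text \<open>Applying g - 1 with g = \<open>diag_pair i j x\<close> kills all coordinates but i and
  j; repeating this with (i,k) leaves only coordinate i, scaled by (x-1)^2. Thus W contains a unit
  vector, and lifts of transpositions carry it to all others.\<close>

lemma ext_irreducible:
  assumes x: "x \<in> ratios" "x \<noteq> 1" and p3: "3 \<le> p"
  shows "irreducible_mats p (ext_group p A w)"
  unfolding irreducible_mats_def
proof (intro allI impI)
  fix W assume "invariant_subspace p (ext_group p A w) W"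
  hence Wc: "W \<subseteq> carrier_vec p" and W0: "0\<^sub>v p \<in> W"
    and Wadd: "\<And>v u. v \<in> W \<Longrightarrow> u \<in> W \<Longrightarrow> v + u \<in> W"
    and Wsm: "\<And>c v. v \<in> W \<Longrightarrow> c \<cdot>\<^sub>v v \<in> W"
    and Wg: "\<And>g v. g \<in> ext_group p A w \<Longrightarrow> v \<in> W \<Longrightarrow> g *\<^sub>v v \<in> W"
    by (auto simp: invariant_subspace_def)
  show "W = {0\<^sub>v p} \<or> W = carrier_vec p"
  proof (cases "W = {0\<^sub>v p}")
    case False
    then obtain v where v: "v \<in> W" "v \<noteq> 0\<^sub>v p" using W0 by auto
    have vc: "v \<in> carrier_vec p" using v Wc by auto
    obtain i where i: "i < p" "v $ i \<noteq> 0"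
    proof (rule ccontr)
      assume "\<not> thesis"
      hence "\<And>i. i < p \<Longrightarrow> v $ i = 0" using that by blast
      hence "v = 0\<^sub>v p" using vc by (intro eq_vecI) auto
      thus False using v by simp
    qed
    have diff: "vec p (\<lambda>k. (a k - 1) * u $ k) \<in> W" if a: "mon p a id \<in> A" and u: "u \<in> W" for a u
    proof -
      have uc: "u \<in> carrier_vec p" using u Wc by auto
      have "mon p a id *\<^sub>v u + (-1) \<cdot>\<^sub>v u \<in> W"
        using a u ext_diag_mem_iff by (intro Wadd Wg Wsm) auto
      moreover have "mon p a id *\<^sub>v u + (-1) \<cdot>\<^sub>v u = vec p (\<lambda>k. (a k - 1) * u $ k)"
        using uc by (intro eq_vecI) (auto simp: mon_mult_vec[OF permutes_id uc] algebra_simps)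
      ultimately show ?thesis by simp
    qed
    obtain j where j: "j < p" "j \<noteq> i" using that[of "if i = 0 then 1 else 0"] p3 by auto
    obtain k where k: "k < p" "k \<noteq> i" "k \<noteq> j"
    proof -
      have "card {i,j} < card {..<p}" using p3 card_insert_le_m1[of 2 "{j}" i] by simp
      hence "\<not> {..<p} \<subseteq> {i,j}" using card_mono[of "{i,j}" "{..<p}"] by auto
      thus thesis using that by auto
    qed
    let ?v1 = "vec p (\<lambda>k. (diag_pair i j x k - 1) * v $ k)"
    let ?v2 = "vec p (\<lambda>l. (diag_pair i k x l - 1) * ?v1 $ l)"
    have "?v1 \<in> W" using diff v(1) diag_pair_mem_iff_ratio[of i j x] i j x p_ge_2 by auto
    hence v2: "?v2 \<in> W" using diff diag_pair_mem_iff_ratio[of i k x] i k x p_ge_2 by auto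
    define c where "c = (x - 1) * ((x - 1) * v $ i)"
    have "c \<noteq> 0" using x i by (simp add: c_def)
    hence "inverse c \<cdot>\<^sub>v ?v2 = unit_vec p i"
      using k j by (intro eq_vecI) (auto simp: diag_pair_def unit_vec_def c_def[symmetric])
    hence ui: "unit_vec p i \<in> W" using Wsm[OF v2] by metis
    have ul: "unit_vec p l \<in> W" if l: "l < p" for l
    proof -
      let ?t = "Transposition.transpose i l"
      have t: "?t permutes {..<p}" using i l by (intro permutes_swap_id) auto
      have "mon p (\<lambda>_. twist w ?t) ?t *\<^sub>v unit_vec p i \<in> W" by (intro Wg twist_perm_mem t ui)
      hence "inverse (twist w ?t) \<cdot>\<^sub>v (mon p (\<lambda>_. twist w ?t) ?t *\<^sub>v unit_vec p i) \<in> W"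
        by (rule Wsm)
      moreover have "inverse (twist w ?t) \<cdot>\<^sub>v (mon p (\<lambda>_. twist w ?t) ?t *\<^sub>v unit_vec p i) = unit_vec p l"
        using twist_nonzero[OF w_nonzero, of ?t] i l
        by (intro eq_vecI) (auto simp: mon_mult_vec[OF t] unit_vec_def Transposition.transpose_def)
      ultimately show ?thesis by simp
    qed
    have "u \<in> W" if u: "u \<in> carrier_vec p" for u
    proof -
      have "vec p (\<lambda>l. if l < n then u $ l else 0) \<in> W" if "n \<le> p" for n
        using that
      proof (induction n)
        case 0
        have "vec p (\<lambda>l. if l < 0 then u $ l else 0) = 0\<^sub>v p" by (intro eq_vecI) auto
        thus ?case using W0 by simp
      next
        case (Suc n)
        have "vec p (\<lambda>l. if l < n then u $ l else 0) + u $ n \<cdot>\<^sub>v unit_vec p n \<in> W"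
          using Suc by (intro Wadd Wsm ul) auto
        moreover have "vec p (\<lambda>l. if l < n then u $ l else 0) + u $ n \<cdot>\<^sub>v unit_vec p n
            = vec p (\<lambda>l. if l < Suc n then u $ l else 0)"
          using Suc.prems by (intro eq_vecI) (auto simp: unit_vec_def less_Suc_eq)
        ultimately show ?case by simp
      qed
      from this[of p] have "vec p (\<lambda>l. if l < p then u $ l else 0) \<in> W" by simp
      moreover have "vec p (\<lambda>l. if l < p then u $ l else 0) = u"
        using u by (intro eq_vecI) auto
      ultimately show ?thesis by simp
    qed
    thus ?thesis using Wc by auto
  qed simp
qed

end

section \<open>Conjugacy of the extensions\<close>

lemma admissible_A_imp_sym_diag_group:
  assumes "admissible_A p A"
  shows "sym_diag_group p A"
proof unfold_locales
  show "matgroup p A" "finite A" "A \<subseteq> diag_mats p" "A \<subseteq> monomial_mats p"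
    using assms diag_mats_subset_monomial_mats by (auto simp: admissible_A_def)
  fix t a assume t: "t permutes {..<p}" and a: "mon p a id \<in> A"
  have "perm_mat p t * mon p a id * perm_mat p (pinv t) \<in> A"
    using assms t a by (auto simp: admissible_A_def Sym_def)
  thus "mon p (a \<circ> t) id \<in> A"
    by (simp add: perm_mat_eq_mon mon_mult[OF t] permutes_inv_o[OF t] comp_def[of a])
qed

context sym_diag_group
begin

text \<open>The third coordinate of \<open>diag_pair 0 1 x\<close> is 1, so it is scalar only for x
  = 1. With p = 2 the scalar -1 would give the ratio -1.\<close>

lemma nonscalar_iff:
  assumes "3 \<le> p"
  shows "\<not> A \<subseteq> scalars p \<longleftrightarrow> (\<exists>x\<in>ratios. x \<noteq> 1)"
proof
  assume "\<not> A \<subseteq> scalars p"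
  then obtain g where g: "g \<in> A" "g \<notin> scalars p" by blast
  obtain a where "g = mon p a id" using mem_diagE[OF g(1)] .
  with g have a: "mon p a id \<in> A" "mon p a id \<notin> scalars p" by simp_all
  have "\<exists>i<p. a i \<noteq> a 0"
  proof (rule ccontr)
    assume "\<not> (\<exists>i<p. a i \<noteq> a 0)"
    hence "mon p a id = scalar_mat p (a 0)" unfolding scalar_mat_eq_mon by (metis (no_types) mon_cong)
    moreover have "a 0 \<noteq> 0" using entry_nonzero[OF a(1), of 0] assms by simp
    ultimately show False using a(2) by (auto simp: scalars_def)
  qed
  then obtain i where i: "i < p" "a i \<noteq> a 0" by blast
  have "a 0 \<noteq> 0" using entry_nonzero[OF a(1), of 0] assms by simp
  hence "a i / a 0 \<noteq> 1" using i by simp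
  moreover have "a i / a 0 \<in> ratios" using ratio_mem[OF a(1)] i assms by simp
  ultimately show "\<exists>x\<in>ratios. x \<noteq> 1" by blast
next
  assume "\<exists>x\<in>ratios. x \<noteq> 1"
  then obtain x where x: "mon p (diag_pair 0 1 x) id \<in> A" "x \<noteq> 1" by (auto simp: ratios_def)
  show "\<not> A \<subseteq> scalars p"
  proof
    assume "A \<subseteq> scalars p"
    then obtain c where "mon p (diag_pair 0 1 x) id = mon p (\<lambda>_. c) id"
      using x by (auto simp: scalars_def scalar_mat_eq_mon)
    hence c: "diag_pair 0 1 x i = c" if "i < p" for i
      using mon_index[OF that that, of "diag_pair 0 1 x" id] mon_index[OF that that, of "\<lambda>_. c" id]
      by simp
    show False using c[of 0] c[of 2] assms x(2) by (simp add: diag_pair_def)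
  qed
qed

lemma card_Z2_part:
  assumes "0 < p"
  shows "card (A \<inter> Z2 p) = card {c. mon p (\<lambda>_. c) id \<in> A \<and> (\<exists>k::nat. c ^ (2 ^ k) = 1)}"
    and "finite {c. mon p (\<lambda>_. c) id \<in> A \<and> (\<exists>k::nat. c ^ (2 ^ k) = 1)}" (is "finite ?S")
proof -
  have inj: "inj_on (\<lambda>c. mon p (\<lambda>_. c) id) ?S"
  proof (rule inj_onI)
    fix c d assume "mon p (\<lambda>_. c) id = mon p (\<lambda>_. d) id"
    hence "mon p (\<lambda>_. c) id $$ (0,0) = mon p (\<lambda>_. d) id $$ (0,0)" by simp
    thus "c = d" using assms by simp
  qed
  have im: "(\<lambda>c. mon p (\<lambda>_. c) id) ` ?S = A \<inter> Z2 p"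
    by (auto simp: Z2_def scalar_mat_eq_mon)
  show "card (A \<inter> Z2 p) = card ?S" using card_image[OF inj] im by simp
  show "finite ?S" using finite_imageD[OF _ inj] im fin by simp
qed

lemma two_scalars_eq_roots:
  assumes "0 < p"
  shows "{c. mon p (\<lambda>_. c) id \<in> A \<and> (\<exists>k::nat. c ^ (2 ^ k) = 1)} = {c. c ^ card (A \<inter> Z2 p) = 1}"
    (is "?S = _")
  unfolding card_Z2_part(1)[OF assms]
proof (rule finite_subgroup_eq_roots_of_unity)
  show "finite ?S" by (rule card_Z2_part(2)[OF assms])
  show "?S \<noteq> {}" using one_mem by (auto intro!: exI[of _ 1])
  show "0 \<notin> ?S" by (auto simp: zero_power)
  fix x y assume "x \<in> ?S" "y \<in> ?S"
  then obtain k l :: nat where kl: "x ^ (2 ^ k) = 1" "y ^ (2 ^ l) = 1"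
    and xy: "mon p (\<lambda>_. x) id \<in> A" "mon p (\<lambda>_. y) id \<in> A" by auto
  have "(x * y) ^ (2 ^ (k + l)) = (x ^ (2 ^ k)) ^ (2 ^ l) * (y ^ (2 ^ l)) ^ (2 ^ k)"
    by (simp add: power_mult_distrib power_add flip: power_mult) (simp add: mult.commute)
  hence "(x * y) ^ (2 ^ (k + l)) = 1" by (simp add: kl)
  thus "x * y \<in> ?S" using diag_mult_mem[OF xy refl] by blast
qed

text \<open>With N the cardinality, a primitive N-th root of unity is one of these scalars, hence
  has 2-power order, and N divides a power of 2. So the exponent n in \<open>R_star\<close> exists
  for each A.\<close>

lemma card_Z2_part_power_of_2:
  assumes "0 < p"
  shows "\<exists>n. card (A \<inter> Z2 p) = 2 ^ n"
proof -
  define N where "N = card (A \<inter> Z2 p)"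
  have "mon p (\<lambda>_. 1) id \<in> A \<and> (\<exists>k::nat. (1::complex) ^ (2 ^ k) = 1)" using one_mem by simp
  hence "N > 0" unfolding N_def card_Z2_part(1)[OF assms]
    using card_Z2_part(2)[OF assms] by (auto simp: card_gt_0_iff)
  hence "cis (2 * pi / N) ^ N = 1" by (simp add: DeMoivre)
  then obtain k :: nat where "cis (2 * pi / N) ^ (2 ^ k) = 1"
    using two_scalars_eq_roots[OF assms] unfolding N_def by blast
  hence "cos (2 ^ k * (2 * pi / N)) = 1" by (simp add: DeMoivre complex_eq_iff)
  then obtain m :: int where "2 ^ k * (2 * pi / N) = m * 2 * pi"
    using cos_one_2pi_int by auto
  hence "2 ^ k = of_int m * real N" using \<open>N > 0\<close> by (simp add: field_simps)
  hence "(of_int (2 ^ k) :: real) = of_int (m * int N)" by simp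
  hence "2 ^ k = m * int N" by (simp only: of_int_eq_iff)
  hence "int N dvd int (2 ^ k)" by simp
  hence "N dvd 2 ^ k" by (simp only: int_dvd_int_iff)
  thus ?thesis using divides_primepow_nat[of 2 N k] by (auto simp: N_def)
qed

lemma two_scalar_mem_iff:
  assumes "0 < p" "card (A \<inter> Z2 p) = 2 ^ n"
  shows "mon p (\<lambda>_. c) id \<in> A \<and> (\<exists>k::nat. c ^ (2 ^ k) = 1) \<longleftrightarrow> c ^ (2 ^ n) = 1"
  using two_scalars_eq_roots[OF assms(1)] unfolding assms(2) by blast

end

text \<open>The elementwise form of the fact that Sym(p) has no nontrivial abelian normal subgroup:
  t and its conjugate t' by u cannot both lie in one. For p = 4 the Klein four-group violates
  this.\<close>

lemma permutation_not_commuting_with_conjugate: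
  fixes t :: "nat \<Rightarrow> nat"
  assumes t: "t permutes {..<p}" "t \<noteq> id" and p: "5 \<le> p"
  obtains u where "u permutes {..<p}" "\<And>t'. u \<circ> t' = t \<circ> u \<Longrightarrow> t' \<circ> t \<noteq> t \<circ> t'"
proof -
  obtain i where i: "t i \<noteq> i" using t(2) by (auto simp: fun_eq_iff simp del: id_apply) (simp add: id_def)
  define j where "j = t i"
  have ip: "i < p" using i permutes_not_in[OF t(1), of i] by auto
  have jp: "j < p" using ip permutes_less[OF t(1)] by (simp add: j_def)
  have avoid: "\<exists>k<p. k \<notin> X" if "finite X" "card X < p" for X
    using that card_mono[of X "{..<p}"] by (force simp: subset_iff)
  have "card {i,j} \<le> 2" by (simp add: card_insert_if)
  then obtain l where l: "l < p" "l \<noteq> i" "l \<noteq> j"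
    using avoid[of "{i,j}"] p by auto
  have "card {i,j,l,t l} \<le> 4" by (simp add: card_insert_if)
  then obtain k where k: "k < p" "k \<noteq> i" "k \<noteq> j" "k \<noteq> l" "k \<noteq> t l"
    using avoid[of "{i,j,l,t l}"] p by auto
  \<comment> \<open>The 3-cycle j -> l -> k -> j, fixing i. It forces t' i = k, and commuting would
    give u (t k) = t l. As k avoids t l, every remaining position of t l contradicts injectivity of
    t.\<close>
  define u where "u = Transposition.transpose j l \<circ> Transposition.transpose l k"
  have u: "u permutes {..<p}"
    unfolding u_def using jp l k by (intro permutes_compose permutes_swap_id) auto
  have ui: "u i = i" "u j = l" "u l = k" "u k = j" "\<And>m. m \<notin> {j,k,l} \<Longrightarrow> u m = m"
    using i l k by (auto simp: u_def j_def Transposition.transpose_def)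
  have uinj: "u x = u y \<Longrightarrow> x = y" for x y using permutes_inj[OF u] by (auto dest: injD)
  have tinj: "t x = t y \<Longrightarrow> x = y" for x y using permutes_inj[OF t(1)] by (auto dest: injD)
  have "t' \<circ> t \<noteq> t \<circ> t'" if c: "u \<circ> t' = t \<circ> u" for t'
  proof
    assume comm: "t' \<circ> t = t \<circ> t'"
    have c': "u (t' m) = t (u m)" for m using c by (metis comp_apply)
    have "u (t' i) = u k" using c'[of i] ui by (simp add: j_def)
    hence "t' i = k" by (rule uinj)
    hence "t' j = t k" using comm by (metis comp_apply j_def)
    hence eq: "u (t k) = t l" using c'[of j] ui by simp
    consider "t l = j" | "t l = l" | "t l \<notin> {j,k,l}" using k by auto
    thus False
    proof cases
      case 1
      thus ?thesis using tinj[of l i] l by (simp add: j_def)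
    next
      case 2
      hence "t k = j" using eq uinj[of "t k" j] ui by simp
      thus ?thesis using tinj[of k i] k by (simp add: j_def)
    next
      case 3
      hence "u (t k) = u (t l)" using eq ui by simp
      thus ?thesis using uinj tinj k by metis
    qed
  qed
  thus thesis using that u by blast
qed

lemma mult_mon_id_index:
  assumes "X \<in> carrier_mat p p" "i < p" "j < p"
  shows "(X * mon p a id) $$ (i,j) = X $$ (i,j) * a j"
proof -
  have "(X * mon p a id) $$ (i,j) = (\<Sum>k\<in>{0..<p}. X $$ (i,k) * (if j = k then a k else 0))"
    using assms by (simp add: scalar_prod_def)
  also have "\<dots> = (\<Sum>k\<in>{0..<p}. if k = j then X $$ (i,j) * a j else 0)"
    by (rule sum.cong) auto
  finally show ?thesis using assms by simp
qed

lemma mon_id_mult_index: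
  assumes "X \<in> carrier_mat p p" "i < p" "j < p"
  shows "(mon p b id * X) $$ (i,j) = b i * X $$ (i,j)"
proof -
  have "(mon p b id * X) $$ (i,j) = (\<Sum>k\<in>{0..<p}. (if k = i then b i else 0) * X $$ (k,j))"
    using assms by (simp add: scalar_prod_def)
  also have "\<dots> = (\<Sum>k\<in>{0..<p}. if k = i then b i * X $$ (i,j) else 0)"
    by (rule sum.cong) auto
  finally show ?thesis using assms by simp
qed

lemma conj_mat_mult:
  fixes X Y g h :: "complex mat"
  assumes "X \<in> carrier_mat p p" "Y \<in> carrier_mat p p" "Y * X = 1\<^sub>m p"
    and "g \<in> carrier_mat p p" "h \<in> carrier_mat p p"
  shows "(X * g * Y) * (X * h * Y) = X * (g * h) * Y"
proof -
  have "(X * g * Y) * (X * h * Y) = X * g * (Y * X) * h * Y"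
    using assms(1,2,4,5) by (simp add: assoc_mult_mat[of _ p p _ p _ p])
  also have "\<dots> = X * (g * h) * Y"
    using assms by (simp add: assms(3) assoc_mult_mat[of _ p p _ p _ p])
  finally show ?thesis .
qed

lemma conj_mat_back:
  fixes X Y g :: "complex mat"
  assumes "X \<in> carrier_mat p p" "Y \<in> carrier_mat p p" "Y * X = 1\<^sub>m p" "g \<in> carrier_mat p p"
  shows "Y * (X * g * Y) * X = g"
proof -
  have "Y * (X * g * Y) * X = (Y * X) * g * (Y * X)"
    using assms(1,2,4) by (simp add: assoc_mult_mat[of _ p p _ p _ p])
  thus ?thesis using assms by simp
qed

locale ext_conjugation =
  A: twisted_ext p A w + B: twisted_ext p B v for p A w B v +
  fixes X Y :: "complex mat"
  assumes p5: "5 \<le> p"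
    and X: "X \<in> carrier_mat p p" and Y: "Y \<in> carrier_mat p p"
    and XY: "X * Y = 1\<^sub>m p" and YX: "Y * X = 1\<^sub>m p"
    and conj: "ext_group p B v = (\<lambda>g. X * g * Y) ` ext_group p A w"
    and nonscalarA: "\<exists>x\<in>A.ratios. x \<noteq> 1" and nonscalarB: "\<exists>x\<in>B.ratios. x \<noteq> 1"
begin

lemmas conj_mult = conj_mat_mult[OF X Y YX]

lemma conj_times_X:
  assumes "g \<in> carrier_mat p p"
  shows "(X * g * Y) * X = X * g"
  using assms X Y YX by (simp add: assoc_mult_mat[of _ p p _ p _ p])

lemmas conj_back = conj_mat_back[OF X Y YX]

lemma conj_mem: "g \<in> ext_group p A w \<Longrightarrow> X * g * Y \<in> ext_group p B v"
  using conj by auto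

text \<open>Each one-sided result can be reused for the inverse conjugation; this supplies A = B and
  the column half of \<open>X_monomial\<close>.\<close>

lemma flip: "ext_conjugation p B v A w Y X"
proof unfold_locales
  have "(\<lambda>g. Y * g * X) ` ext_group p B v = (\<lambda>g. Y * (X * g * Y) * X) ` ext_group p A w"
    unfolding conj by (simp add: image_image)
  also have "\<dots> = (\<lambda>g. g) ` ext_group p A w"
    by (rule image_cong) (use conj_back A.ext_monomial in \<open>auto simp: monomial_mats_def\<close>)
  finally show "ext_group p A w = (\<lambda>g. Y * g * X) ` ext_group p B v" by simp
qed (fact p5 X Y XY YX nonscalarA nonscalarB)+

text \<open>The diagonal part of each group is its largest abelian normal subgroup, so conjugation
  has to respect it.\<close>

lemma conj_diag_mem:
  assumes a: "mon p a id \<in> A"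
  shows "X * mon p a id * Y \<in> B"
proof -
  have mem: "\<exists>b t. X * mon p a id * Y = mon p b t \<and> t permutes {..<p} \<and> mon p b t \<in> ext_group p B v"
    if "mon p a id \<in> A" for a
    using conj_mem[of "mon p a id"] that A.ext_diag_mem_iff B.ext.mem_monE by metis
  obtain b t where b: "X * mon p a id * Y = mon p b t" "t permutes {..<p}" "mon p b t \<in> ext_group p B v"
    using mem[OF a] by blast
  have "t = id"
  proof (rule ccontr)
    assume "t \<noteq> id"
    then obtain u where u: "u permutes {..<p}" "\<And>t'. u \<circ> t' = t \<circ> u \<Longrightarrow> t' \<circ> t \<noteq> t \<circ> t'"
      using permutation_not_commuting_with_conjugate[OF b(2) _ p5] by blast
    have uB: "mon p (\<lambda>_. twist v u) u \<in> ext_group p B v" by (rule B.twist_perm_mem[OF u(1)])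
    then obtain g where g: "g \<in> ext_group p A w" "mon p (\<lambda>_. twist v u) u = X * g * Y"
      using conj by auto
    obtain e s where e: "g = mon p e s" "s permutes {..<p}" using A.ext.mem_monE[OF g(1)] by blast
    \<comment> \<open>This is the conjugate of a by the preimage g of the lift of u. Its image under
      X has permutation part u^{-1} t u, yet commutes with the image of a because A is
      abelian.\<close>
    have a': "mon p (a \<circ> s) id \<in> A" using A.sym[OF e(2) a] .
    obtain b' t' where b': "X * mon p (a \<circ> s) id * Y = mon p b' t'" "t' permutes {..<p}"
        "mon p b' t' \<in> ext_group p B v"
      using mem[OF a'] by blast
    have "mon p (a \<circ> s) id * g = g * mon p a id"
      unfolding e mon_mult[OF permutes_id] mon_mult[OF e(2)] by (simp add: mult.commute)
    hence "mon p b' t' * mon p (\<lambda>_. twist v u) u = mon p (\<lambda>_. twist v u) u * mon p b t"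
      unfolding b(1)[symmetric] b'(1)[symmetric] g(2) by (simp add: conj_mult e)
    hence eq: "mon p (\<lambda>i. b' i * twist v u) (u \<circ> t') = mon p (\<lambda>i. twist v u * b (u i)) (t \<circ> u)"
      by (simp add: mon_mult[OF b'(2)] mon_mult[OF u(1)])
    have nz: "b' i * twist v u \<noteq> 0" if "i < p" for i
      using B.ext.entry_nonzero[OF b'(3) that] twist_nonzero[OF B.w_nonzero] by simp
    have 1: "u \<circ> t' = t \<circ> u"
      by (rule mon_eqD(1)[OF eq _ _ nz]) (auto intro: permutes_compose u b b')
    have "mon p a id * mon p (a \<circ> s) id = mon p (a \<circ> s) id * mon p a id"
      by (simp add: mon_mult[OF permutes_id] mult.commute)
    hence "mon p b t * mon p b' t' = mon p b' t' * mon p b t"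
      unfolding b(1)[symmetric] b'(1)[symmetric] by (simp add: conj_mult)
    hence eq2: "mon p (\<lambda>i. b i * b' (t i)) (t' \<circ> t) = mon p (\<lambda>i. b' i * b (t' i)) (t \<circ> t')"
      by (simp add: mon_mult[OF b'(2)] mon_mult[OF b(2)])
    have nz2: "b i * b' (t i) \<noteq> 0" if "i < p" for i
      using B.ext.entry_nonzero[OF b'(3)] B.ext.entry_nonzero[OF b(3)] that permutes_less[OF b(2)]
      by simp
    have "t' \<circ> t = t \<circ> t'"
      by (rule mon_eqD(1)[OF eq2 _ _ nz2]) (auto intro: permutes_compose b b')
    thus False using u(2)[OF 1] by simp
  qed
  thus ?thesis using b B.ext_diag_mem_iff by simp
qed

text \<open>X intertwines a diagonal a with its diagonal image b, so a nonzero entry X_{i,m} forces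
  a_m = b_i. For a = \<open>diag_pair j l x\<close> with l off {j,k} the values a_j = x and a_k = 1
  cannot agree.\<close>

lemma row_unique:
  assumes "i < p" "j < p" "k < p" "X $$ (i,j) \<noteq> 0" "X $$ (i,k) \<noteq> 0"
  shows "j = k"
proof (rule ccontr)
  assume jk: "j \<noteq> k"
  obtain x where x: "x \<in> A.ratios" "x \<noteq> 1" using nonscalarA by blast
  have "\<not> {..<p} \<subseteq> {j,k}" using card_mono[of "{j,k}" "{..<p}"] p5 jk by auto
  then obtain l where l: "l < p" "l \<noteq> j" "l \<noteq> k" by auto
  have a: "mon p (diag_pair j l x) id \<in> A" using A.diag_pair_mem_iff_ratio l assms x by auto
  obtain b where b: "X * mon p (diag_pair j l x) id * Y = mon p b id"
    using B.mem_diagE[OF conj_diag_mem[OF a]] by blast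
  have eq: "X * mon p (diag_pair j l x) id = mon p b id * X"
    using conj_times_X[of "mon p (diag_pair j l x) id"] b by simp
  have "X $$ (i,m) * diag_pair j l x m = b i * X $$ (i,m)" if "m < p" for m
    using mult_mon_id_index[OF X assms(1) that, of "diag_pair j l x"] mon_id_mult_index[OF X assms(1) that, of b] eq
    by (metis (no_types))
  from this[of j] this[of k] have "x = b i" "1 = b i"
    using assms l jk by (auto simp: diag_pair_def)
  thus False using x by simp
qed

text \<open>Here a diagonal element of B is pulled back to A: two nonzero entries in a column would
  equate two of its diagonal entries, x and 1.\<close>

lemma col_unique:
  assumes "i < p" "j < p" "k < p" "X $$ (j,i) \<noteq> 0" "X $$ (k,i) \<noteq> 0"
  shows "j = k"
proof (rule ccontr)
  assume jk: "j \<noteq> k"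
  interpret f: ext_conjugation p B v A w Y X by (rule flip)
  obtain x where x: "x \<in> B.ratios" "x \<noteq> 1" using nonscalarB by blast
  have "\<not> {..<p} \<subseteq> {j,k}" using card_mono[of "{j,k}" "{..<p}"] p5 jk by auto
  then obtain l where l: "l < p" "l \<noteq> j" "l \<noteq> k" by auto
  let ?b = "mon p (diag_pair j l x) id"
  have b: "?b \<in> B" using B.diag_pair_mem_iff_ratio l assms x by auto
  obtain a where a: "Y * ?b * X = mon p a id"
    using A.mem_diagE[OF f.conj_diag_mem[OF b]] by blast
  have "X * mon p a id = X * (Y * ?b * X)" using a by simp
  also have "\<dots> = (X * Y) * ?b * X" using X Y by (simp add: assoc_mult_mat[of _ p p _ p _ p])
  also have "\<dots> = ?b * X" using XY X by simp
  finally have eq: "X * mon p a id = ?b * X" .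
  have "X $$ (m,i) * a i = diag_pair j l x m * X $$ (m,i)" if "m < p" for m
    using mult_mon_id_index[OF X that assms(1), of a] mon_id_mult_index[OF X that assms(1), of "diag_pair j l x"] eq
    by (metis (no_types))
  from this[of j] this[of k] have "x = a i" "1 = a i"
    using assms l jk by (auto simp: diag_pair_def)
  thus False using x by simp
qed

lemma X_monomial: "X \<in> monomial_mats p"
proof -
  have row: "\<exists>j<p. X $$ (i,j) \<noteq> 0" if i: "i < p" for i
  proof (rule ccontr)
    assume "\<not> (\<exists>j<p. X $$ (i,j) \<noteq> 0)"
    hence "(X * Y) $$ (i,i) = 0" using i X Y by (simp add: scalar_prod_def)
    thus False using i XY by simp
  qed
  have col: "\<exists>i<p. X $$ (i,j) \<noteq> 0" if j: "j < p" for j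
  proof (rule ccontr)
    assume "\<not> (\<exists>i<p. X $$ (i,j) \<noteq> 0)"
    hence "(Y * X) $$ (j,j) = 0" using j X Y by (simp add: scalar_prod_def)
    thus False using j YX by simp
  qed
  have "\<exists>!j. j < p \<and> X $$ (i,j) \<noteq> 0" if "i < p" for i
    using row[OF that] row_unique[OF that] by blast
  moreover have "\<exists>!i. i < p \<and> X $$ (i,j) \<noteq> 0" if "j < p" for j
    using col[OF that] col_unique[OF that] by blast
  ultimately show ?thesis using X by (auto simp: monomial_mats_def)
qed

text \<open>A monomial conjugator only permutes the entries of a, and B is invariant under
  permutations, so a itself lies in B.\<close>

lemma diag_subset: "A \<subseteq> B"
proof
  fix g assume g: "g \<in> A"
  obtain a where a: "g = mon p a id" using A.mem_diagE[OF g] by blast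
  obtain x t where x: "t permutes {..<p}" "\<And>i. i < p \<Longrightarrow> x i \<noteq> 0" "X = mon p x t"
    using monomial_matsE[OF X_monomial] by blast
  have "X * mon p a id = mon p (a \<circ> t) id * X"
    unfolding x(3) mon_mult[OF x(1)] mon_mult[OF permutes_id] by (simp add: mult.commute)
  hence "X * mon p a id * Y = mon p (a \<circ> t) id * (X * Y)"
    using X Y by (simp add: assoc_mult_mat[of _ p p _ p _ p])
  hence "mon p (a \<circ> t) id \<in> B" using conj_diag_mem[of a] g a XY by simp
  from B.sym[OF permutes_inv[OF x(1)] this] show "g \<in> B"
    using permutes_inverses(1)[OF x(1)] by (simp add: a o_def)
qed

text \<open>The image of the untwisted (0 1) is a transposition (i j) with coefficients x_i/x_j,
  x_j/x_i and 1 elsewhere; divided by v, these coefficients form an element of B. Comparing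
  coordinate i with a third one puts x_i/x_j into the ratio group, and removing that pair leaves the
  scalar v.\<close>

lemma twist_scalar_mem:
  assumes w: "w = 1"
  shows "mon p (\<lambda>_. v) id \<in> A"
proof -
  interpret f: ext_conjugation p B v A w Y X by (rule flip)
  have AB: "A = B" using diag_subset f.diag_subset by auto
  obtain x t where x: "t permutes {..<p}" "\<And>i. i < p \<Longrightarrow> x i \<noteq> 0" "X = mon p x t"
    using monomial_matsE[OF X_monomial] by blast
  let ?u = "Transposition.transpose 0 (1::nat)"
  have u: "?u permutes {..<p}" using p5 by (intro permutes_swap_id) auto
  have "mon p (\<lambda>_. 1) ?u \<in> ext_group p A w"
    using A.twist_perm_mem[OF u] by (simp add: w twist_def)
  hence "X * mon p (\<lambda>_. 1) ?u * Y \<in> ext_group p B v" by (rule conj_mem)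
  then obtain d s where d: "X * mon p (\<lambda>_. 1) ?u * Y = mon p d s" "s permutes {..<p}"
      "mon p (\<lambda>i. d i / twist v s) id \<in> B"
    using B.ext_memE by metis
  have dnz: "d i \<noteq> 0" if "i < p" for i using B.entry_nonzero[OF d(3) that] by auto
  have "mon p d s * X = X * mon p (\<lambda>_. 1) ?u" using conj_times_X[OF mon_carrier] unfolding d(1)[symmetric] .
  hence eq: "mon p (\<lambda>i. d i * x (s i)) (t \<circ> s) = mon p (\<lambda>i. x i) (?u \<circ> t)"
    unfolding x(3) by (simp add: mon_mult[OF d(2)] mon_mult[OF x(1)])
  have nz: "d i * x (s i) \<noteq> 0" if "i < p" for i
    using dnz[OF that] x(2)[of "s i"] permutes_less[OF d(2)] that by simp
  have ts: "t \<circ> s = ?u \<circ> t"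
    by (rule mon_eqD(1)[OF eq _ _ nz]) (intro permutes_compose d(2) x(1) u)+
  have dx: "d i * x (s i) = x i" if "i < p" for i
    by (rule mon_eqD(2)[OF eq _ _ nz that]) (intro permutes_compose d(2) x(1) u)+
  have "evenperm s \<longleftrightarrow> evenperm ?u"
    using ts evenperm_comp[of t s] evenperm_comp[of ?u t] permutes_lessThan_permutation x(1) d(2) u
    by metis
  hence tw: "twist v s = v" by (simp add: twist_def evenperm_swap)
  define i j where "i = pinv t 0" and "j = pinv t 1"
  have tij: "t i = 0" "t j = 1" using permutes_inverses(1)[OF x(1)] by (auto simp: i_def j_def)
  have tinj: "t y = t z \<Longrightarrow> y = z" for y z using permutes_inj[OF x(1)] by (auto dest: injD)
  have ts': "t (s m) = ?u (t m)" for m using ts by (metis comp_apply)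
  have s: "s i = j" "s j = i" "m \<noteq> i \<Longrightarrow> m \<noteq> j \<Longrightarrow> s m = m" for m
  proof -
    show "s i = j" "s j = i" using ts'[of i] ts'[of j] tij by (auto intro: tinj)
    assume "m \<noteq> i" "m \<noteq> j"
    hence "t m \<noteq> 0" "t m \<noteq> 1" using tij tinj by metis+
    thus "s m = m" using ts'[of m] by (auto intro: tinj)
  qed
  have ij: "i < p" "j < p" "i \<noteq> j" using tij p5 permutes_less[OF x(1), of i] permutes_less[OF x(1), of j] by auto
  have dm: "d m = diag_pair i j (x i / x j) m" if "m < p" for m
    using dx[OF that] s(1,2) s(3)[of m] x(2)[OF that] x(2)[OF ij(1)] x(2)[OF ij(2)] ij
    by (auto simp: diag_pair_def field_simps)
  have "\<not> {..<p} \<subseteq> {i,j}" using card_mono[of "{i,j}" "{..<p}"] p5 ij by auto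
  then obtain k where k: "k < p" "k \<noteq> i" "k \<noteq> j" by auto
  have "x i / x j \<in> B.ratios"
    using B.ratio_mem[OF d(3) ij(1) k(1) B.p_ge_2] k B.w_nonzero
    by (simp add: tw dm ij diag_pair_def)
  hence "mon p (diag_pair i j (x i / x j)) id \<in> B" using B.diag_pair_mem_iff_ratio ij by simp
  from B.diag_divide_mem[OF this d(3) refl] have "mon p (\<lambda>_. v) id \<in> B"
    by (rule B.mem_cong) (use dnz B.w_nonzero in \<open>simp add: tw dm[symmetric]\<close>)
  thus ?thesis using AB by simp
qed

end

section \<open>The groups of \<open>R_star\<close> as twisted extensions\<close>

definition star_data :: "nat \<Rightarrow> complex mat set \<Rightarrow> complex \<Rightarrow> bool" where
  "star_data p A w \<longleftrightarrow> admissible_A p A \<and>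
    (w = 1 \<or> (\<exists>n. card (A \<inter> Z2 p) = 2 ^ n \<and> w = cis (2 * pi / real (2 ^ (n + 1)))))"

lemma cis_power_half: "cis (2 * pi / real (2 ^ (n + 1))) ^ (2 ^ n) = -1"
  by (simp add: DeMoivre)

text \<open>For w = z_{2^(n+1)} the power w^(2^n) is -1, so w^2 is a 2^n-th root of unity and hence
  one of the 2-power scalars in A.\<close>

lemma star_data_imp_twisted_ext:
  assumes "star_data p A w" "2 \<le> p"
  shows "twisted_ext p A w"
proof -
  interpret sym_diag_group p A
    using assms admissible_A_imp_sym_diag_group by (simp add: star_data_def)
  have "mon p (\<lambda>_. w\<^sup>2) id \<in> A"
  proof (cases "w = 1")
    case False
    then obtain n where n: "card (A \<inter> Z2 p) = 2 ^ n" "w = cis (2 * pi / real (2 ^ (n + 1)))"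
      using assms by (auto simp: star_data_def)
    have "(w\<^sup>2) ^ (2 ^ n) = (w ^ (2 ^ n))\<^sup>2" by (simp flip: power_mult add: mult.commute)
    hence "(w\<^sup>2) ^ (2 ^ n) = 1" using cis_power_half[of n] n(2) by simp
    thus ?thesis using two_scalar_mem_iff[OF _ n(1), of "w\<^sup>2"] assms(2) by linarith
  qed (use one_mem in simp)
  thus ?thesis using assms by unfold_locales
qed

lemma R_star_eq:
  assumes "odd p" "2 \<le> p"
  shows "R_star p = {ext_group p A w | A w. star_data p A w}"
proof -
  have 1: "gen_group p ({s_mat p, r_mat p * scalar_mat p w} \<union> A) = ext_group p A w"
    if "star_data p A w" for A w
    using twisted_ext.gen_group_eq_ext[OF star_data_imp_twisted_ext[OF that assms(2)] assms(1)] .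
  have 2: "r_mat p = r_mat p * scalar_mat p 1"
    unfolding r_mat_scalar_eq_mon[OF assms(2)] by (rule r_mat_eq_mon)
  have 3: "G \<in> R_star p \<longleftrightarrow> (\<exists>A w. star_data p A w \<and>
      G = gen_group p ({s_mat p, r_mat p * scalar_mat p w} \<union> A))" for G
  proof
    assume "G \<in> R_star p"
    then obtain A where A: "admissible_A p A"
      and G: "G = gen_group p ({s_mat p, r_mat p} \<union> A) \<or> (\<exists>n. card (A \<inter> Z2 p) = 2 ^ n \<and>
        G = gen_group p ({s_mat p, r_mat p * z_mat p (2 ^ (n + 1))} \<union> A))"
      unfolding R_star_def by blast
    from G show "\<exists>A w. star_data p A w \<and> G = gen_group p ({s_mat p, r_mat p * scalar_mat p w} \<union> A)"
    proof
      assume "G = gen_group p ({s_mat p, r_mat p} \<union> A)"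
      thus ?thesis using A 2 unfolding star_data_def by metis
    next
      assume "\<exists>n. card (A \<inter> Z2 p) = 2 ^ n \<and>
        G = gen_group p ({s_mat p, r_mat p * z_mat p (2 ^ (n + 1))} \<union> A)"
      thus ?thesis using A unfolding star_data_def z_mat_def by blast
    qed
  next
    assume "\<exists>A w. star_data p A w \<and> G = gen_group p ({s_mat p, r_mat p * scalar_mat p w} \<union> A)"
    thus "G \<in> R_star p" unfolding R_star_def star_data_def z_mat_def mem_Collect_eq using 2 by metis
  qed
  have "G \<in> R_star p \<longleftrightarrow> (\<exists>A w. star_data p A w \<and> G = ext_group p A w)" for G
    unfolding 3 using 1 by metis
  thus ?thesis by blast
qed

locale star_group = twisted_ext p A w for p A w +
  assumes star: "star_data p A w" and p_ge_5: "5 \<le> p"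
begin

lemma nontrivial_ratio: "\<exists>x\<in>ratios. x \<noteq> 1"
  using star nonscalar_iff p_ge_5 by (simp add: star_data_def admissible_A_def)

text \<open>A scalar z_{2^(n+1)} in A would have 2-power order and so be a 2^n-th root of unity, but
  its 2^n-th power is -1.\<close>

lemma w_mem_imp_eq_1:
  assumes "mon p (\<lambda>_. w) id \<in> A"
  shows "w = 1"
proof (rule ccontr)
  assume "w \<noteq> 1"
  then obtain n where n: "card (A \<inter> Z2 p) = 2 ^ n" "w = cis (2 * pi / real (2 ^ (n + 1)))"
    using star by (auto simp: star_data_def)
  have "w ^ (2 ^ (n + 1)) = (w ^ (2 ^ n))\<^sup>2" by (simp flip: power_mult add: mult.commute)
  hence "w ^ (2 ^ (n + 1)) = 1" using cis_power_half[of n] n(2) by simp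
  hence "\<exists>k::nat. w ^ (2 ^ k) = 1" by blast
  hence "w ^ (2 ^ n) = 1" using two_scalar_mem_iff[OF _ n(1), of w] assms p_ge_5 by simp
  thus False using cis_power_half[of n] n(2) by simp
qed

end

lemma star_data_imp_star_group: "star_data p A w \<Longrightarrow> 5 \<le> p \<Longrightarrow> star_group p A w"
  by (intro star_group.intro star_group_axioms.intro star_data_imp_twisted_ext) auto

lemma GL_conjugate_sym:
  assumes "GL_conjugate p G H" "G \<subseteq> carrier_mat p p"
  shows "GL_conjugate p H G"
proof -
  obtain X Y where X: "X \<in> carrier_mat p p" "Y \<in> carrier_mat p p" "X * Y = 1\<^sub>m p" "Y * X = 1\<^sub>m p"
    and H: "H = (\<lambda>g. X * g * Y) ` G" using assms by (auto simp: GL_conjugate_def)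
  have "Y * (X * g * Y) * X = g" if "g \<in> G" for g
    using conj_mat_back[OF X(1,2,4)] that assms(2) by auto
  hence "G = (\<lambda>g. Y * g * X) ` H" unfolding H by (force simp: image_image)
  thus ?thesis using X by (auto simp: GL_conjugate_def)
qed

lemma star_groups_not_conjugate:
  assumes AB: "star_group p A w" "star_group p B v"
    and conj: "GL_conjugate p (ext_group p A w) (ext_group p B v)"
  shows "A = B" "w = 1 \<Longrightarrow> v = 1"
proof -
  interpret A: star_group p A w by fact
  interpret B: star_group p B v by fact
  obtain X Y where "X \<in> carrier_mat p p" "Y \<in> carrier_mat p p" "X * Y = 1\<^sub>m p" "Y * X = 1\<^sub>m p"
    "ext_group p B v = (\<lambda>g. X * g * Y) ` ext_group p A w"
    using conj by (auto simp: GL_conjugate_def)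
  then interpret c: ext_conjugation p A w B v X Y
    using A.p_ge_5 A.nontrivial_ratio B.nontrivial_ratio by unfold_locales auto
  interpret f: ext_conjugation p B v A w Y X by (rule c.flip)
  show eq: "A = B" using c.diag_subset f.diag_subset by auto
  show "v = 1" if "w = 1"
    using B.w_mem_imp_eq_1 c.twist_scalar_mem[OF that] eq by simp
qed

lemma R_star_not_conjugate:
  assumes "odd p" "5 \<le> p" "G \<in> R_star p" "H \<in> R_star p" "GL_conjugate p G H"
  shows "G = H"
proof -
  have Req: "R_star p = {ext_group p A w | A w. star_data p A w}"
    using assms by (intro R_star_eq) auto
  obtain A w where A: "star_data p A w" "G = ext_group p A w" using Req assms by auto
  obtain B v where B: "star_data p B v" "H = ext_group p B v" using Req assms by auto
  interpret A: star_group p A w using A assms star_data_imp_star_group by auto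
  interpret B: star_group p B v using B assms star_data_imp_star_group by auto
  have "G \<subseteq> carrier_mat p p" using A.ext_monomial A(2) by (auto simp: monomial_mats_def)
  hence sym: "GL_conjugate p H G" using GL_conjugate_sym assms by blast
  have "A = B" "w = 1 \<longleftrightarrow> v = 1"
    using star_groups_not_conjugate[OF A.star_group_axioms B.star_group_axioms]
      star_groups_not_conjugate[OF B.star_group_axioms A.star_group_axioms] assms(5) sym A B
    by auto
  \<comment> \<open>If neither is 1, then A = B gives the same cardinality 2^n, hence the same n and
    the same root.\<close>
  moreover from this have "w = v" using A(1) B(1) by (auto simp: star_data_def)
  ultimately show ?thesis using A B by simp
qed

lemma R_star_properties:
  assumes "odd p" "5 \<le> p" "G \<in> R_star p"
  shows "matgroup p G \<and> finite G \<and> G \<subseteq> monomial_mats p \<and> irreducible_mats p G \<and> perm_part p G = Sym p"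
proof -
  obtain A w where A: "star_data p A w" "G = ext_group p A w"
    using R_star_eq[of p] assms by auto
  interpret star_group p A w using A assms star_data_imp_star_group by auto
  show ?thesis
    unfolding A(2) using ext_matgroup ext_finite ext_monomial ext_perm_part nontrivial_ratio
      ext_irreducible p_ge_5 by auto
qed

section \<open>Projective cocycles on the symmetric group\<close>

text \<open>\<open>\<rho> t i j\<close> abstracts the m-th power of d_i/d_j for a lift of t:
  \<open>comp\<close> mirrors the product rule of \<open>mon\<close>, \<open>ratio\<close> the fact
  that the values are quotients.\<close>

locale projective_cocycle =
  fixes p :: nat and \<rho> :: "(nat \<Rightarrow> nat) \<Rightarrow> nat \<Rightarrow> nat \<Rightarrow> complex"
  assumes p5: "5 \<le> p"
    and nz: "\<And>t i j. t permutes {..<p} \<Longrightarrow> i < p \<Longrightarrow> j < p \<Longrightarrow> \<rho> t i j \<noteq> 0"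
    and comp: "\<And>t u i j. t permutes {..<p} \<Longrightarrow> u permutes {..<p} \<Longrightarrow> i < p \<Longrightarrow> j < p
      \<Longrightarrow> \<rho> (u \<circ> t) i j = \<rho> t i j * \<rho> u (t i) (t j)"
    and ratio: "\<And>t i j k. t permutes {..<p} \<Longrightarrow> i < p \<Longrightarrow> j < p \<Longrightarrow> k < p
      \<Longrightarrow> \<rho> t i j * \<rho> t j k = \<rho> t i k"
begin

lemma self: "t permutes {..<p} \<Longrightarrow> i < p \<Longrightarrow> \<rho> t i i = 1"
  using ratio[of t i i i] nz[of t i i] by simp

lemma id_eq_1: "i < p \<Longrightarrow> j < p \<Longrightarrow> \<rho> id i j = 1"
  using comp[of id id i j] nz[of id i j] by (simp add: permutes_id)

lemma avoid: "finite X \<Longrightarrow> card X < p \<Longrightarrow> \<exists>m<p. m \<notin> X"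
  using card_mono[of X "{..<p}"] by (force simp: subset_iff)

text \<open>A third point \<open>m\<close> off the transposition \<open>(k l)\<close> exists because \<open>p \<ge> 5\<close>. Conjugation by
  transpositions disjoint from it shows that the values at \<open>(i,j)\<close>, \<open>(j,m)\<close> and \<open>(i,m)\<close> agree,
  and the third is the product of the first two. This rules out the sign character.\<close>

lemma transposition_eq_1:
  assumes "i < p" "j < p" "i \<noteq> j" "k < p" "l < p" "k \<notin> {i,j}" "l \<notin> {i,j}"
  shows "\<rho> (Transposition.transpose k l) i j = 1"
proof -
  let ?t = "Transposition.transpose k l"
  have t: "?t permutes {..<p}" using assms by (intro permutes_swap_id) auto
  have "card {i,j,k,l} \<le> 4" by (simp add: card_insert_if)
  then obtain m where m: "m < p" "m \<noteq> i" "m \<noteq> j" "m \<noteq> k" "m \<noteq> l"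
    using avoid[of "{i,j,k,l}"] p5 by auto
  have conj: "\<rho> ?t c d = \<rho> ?t (Transposition.transpose a b c) (Transposition.transpose a b d)"
    if "a \<in> {i,j,m}" "b \<in> {i,j,m}" "c \<in> {i,j,m}" "d \<in> {i,j,m}" for a b c d
  proof -
    let ?u = "Transposition.transpose a b"
    have lt: "a < p" "b < p" "c < p" "d < p" using that assms m by auto
    have u: "?u permutes {..<p}" using lt by (intro permutes_swap_id) auto
    have comm: "?u \<circ> ?t = ?t \<circ> ?u"
      using that assms m by (intro swap_id_independent) auto
    have "?t c = c" "?t d = d" using that assms m by (auto intro!: transpose_apply_other)
    hence "\<rho> (?u \<circ> ?t) c d = \<rho> ?t c d * \<rho> ?u c d" using comp[OF t u lt(3,4)] by simp
    moreover have "\<rho> (?t \<circ> ?u) c d = \<rho> ?u c d * \<rho> ?t (?u c) (?u d)" using comp[OF u t lt(3,4)] .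
    ultimately show ?thesis using comm nz[OF u lt(3,4)] by simp
  qed
  have "\<rho> ?t i j = \<rho> ?t i m" using conj[of j m i j] assms m by simp
  moreover have "\<rho> ?t i m = \<rho> ?t j m" using conj[of i j i m] assms m by simp
  moreover have "\<rho> ?t i j * \<rho> ?t j m = \<rho> ?t i m" using ratio[OF t] assms m by simp
  ultimately show ?thesis using nz[OF t assms(1,2)] by simp
qed

text \<open>On the pointwise stabilizer of i and j the rule \<open>comp\<close> makes \<rho>
  multiplicative, and the stabilizer is generated by transpositions, where the value is 1.\<close>

lemma stabilizer_eq_1:
  assumes ij: "i < p" "j < p" "i \<noteq> j" and t: "t permutes {..<p}" "t i = i" "t j = j"
  shows "\<rho> t i j = 1"
proof -
  have "t permutes {..<p} - {i,j}"
    by (rule permutes_superset[OF t(1)]) (use t in auto)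
  moreover have "finite ({..<p} - {i,j})" by simp
  ultimately show ?thesis
  proof (induction t rule: permutes_induct)
    case id
    show ?case using ij id_eq_1 by (simp add: id_def)
  next
    case (swap a b s)
    have s: "s permutes {..<p}" using swap.hyps(4) by (rule permutes_subset) auto
    have ab: "Transposition.transpose a b permutes {..<p}"
      using swap.hyps by (intro permutes_swap_id) auto
    have "s i = i" "s j = j" using permutes_not_in[OF swap.hyps(4)] by auto
    thus ?case
      using comp[OF s ab ij(1,2)] swap.IH transposition_eq_1[OF ij, of a b] swap.hyps
      by (simp del: comp_apply o_apply)
  qed
qed

text \<open>A primitive of the cocycle on ordered pairs of distinct points. The choice of h is
  harmless, as two choices differ by an element fixing 0 and 1. With the arguments in the order 1 0,
  \<open>T i j\<close> becomes a constant times x_j/x_i.\<close>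

definition T :: "nat \<Rightarrow> nat \<Rightarrow> complex" where
  "T i j = \<rho> (SOME h. h permutes {..<p} \<and> h 0 = i \<and> h 1 = j) 1 0"

lemma T_eq:
  assumes h: "h permutes {..<p}"
  shows "T (h 0) (h 1) = \<rho> h 1 0"
proof -
  define k where "k = (SOME k. k permutes {..<p} \<and> k 0 = h 0 \<and> k 1 = h 1)"
  have k: "k permutes {..<p}" "k 0 = h 0" "k 1 = h 1"
    unfolding k_def using someI[of "\<lambda>k. k permutes {..<p} \<and> k 0 = h 0 \<and> k 1 = h 1" h] h by auto
  let ?g = "pinv k \<circ> h"
  have g: "?g permutes {..<p}" using h permutes_inv[OF k(1)] by (rule permutes_compose)
  have g01: "?g 0 = 0" "?g 1 = 1"
    using permutes_inverses(2)[OF k(1)] k(2,3) by (metis comp_apply)+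
  have "k \<circ> ?g = h" using permutes_inverses(1)[OF k(1)] by (simp add: fun_eq_iff)
  hence "\<rho> h 1 0 = \<rho> ?g 1 0 * \<rho> k (?g 1) (?g 0)" using comp[OF g k(1), of 1 0] p5 by simp
  also have "\<dots> = \<rho> k 1 0" using stabilizer_eq_1[OF _ _ _ g, of 1 0] g01 p5 by simp
  finally show ?thesis by (simp add: T_def k_def)
qed

lemma T_perm:
  assumes "i < p" "j < p" "i \<noteq> j" "t permutes {..<p}"
  shows "T (t i) (t j) = T i j * \<rho> t j i" and "T i j \<noteq> 0"
proof -
  obtain h where h: "h permutes {..<p}" "h 0 = i" "h 1 = j"
    using permutation_through2[of 0 p 1 i j] assms p5 by auto
  have "T (t i) (t j) = \<rho> (t \<circ> h) 1 0"
    using T_eq[OF permutes_compose[OF h(1) assms(4)]] h by simp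
  also have "\<dots> = \<rho> h 1 0 * \<rho> t j i" using comp[OF h(1) assms(4), of 1 0] h p5 by simp
  finally show "T (t i) (t j) = T i j * \<rho> t j i" using T_eq[OF h(1)] h by simp
  show "T i j \<noteq> 0" using T_eq[OF h(1)] h nz[OF h(1), of 1 0] p5 by simp
qed

text \<open>It remains to split \<open>T\<close> into a function of single points. By 3-transitivity
  and \<open>ratio\<close>, the defect T i j T j k / T i k is one constant \<tau>; so T/\<tau>
  multiplies along paths, and T 0 j / \<tau> is its potential with base point 0.\<close>

lemma coboundary:
  obtains x where "\<And>i. i < p \<Longrightarrow> x i \<noteq> 0"
    "\<And>t i j. t permutes {..<p} \<Longrightarrow> i < p \<Longrightarrow> j < p
      \<Longrightarrow> \<rho> t i j = (x (t i) / x (t j)) / (x i / x j)"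
proof -
  define \<tau> where "\<tau> = T 0 1 * T 1 2 / T 0 2"
  have id: "id permutes {..<p}" by (rule permutes_id)
  have T0: "T i j \<noteq> 0" if "i < p" "j < p" "i \<noteq> j" for i j
    using T_perm(2)[OF that id] .
  have tau: "T i j * T j k = \<tau> * T i k"
    if "i < p" "j < p" "k < p" "i \<noteq> j" "i \<noteq> k" "j \<noteq> k" for i j k
  proof -
    note ijk = that
    have p: "0 < p" "1 < p" "2 < p" using p5 by auto
    obtain t where t: "t permutes {..<p}" "t 0 = i" "t 1 = j" "t 2 = k"
      by (rule permutation_through3[of 0 p 1 2 i j k]) (use p ijk in simp_all)
    have e: "T i j = T 0 1 * \<rho> t 1 0" "T j k = T 1 2 * \<rho> t 2 1" "T i k = T 0 2 * \<rho> t 2 0"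
      using T_perm(1)[OF _ _ _ t(1), of 0 1] T_perm(1)[OF _ _ _ t(1), of 1 2]
        T_perm(1)[OF _ _ _ t(1), of 0 2] t p by auto
    have "\<rho> t 2 1 * \<rho> t 1 0 = \<rho> t 2 0" using ratio[OF t(1)] p by simp
    thus ?thesis using T0[of 0 2] p by (simp add: e \<tau>_def mult_ac)
  qed
  have tau0: "\<tau> \<noteq> 0" using T0 p5 by (simp add: \<tau>_def)
  \<comment> \<open>\<open>T 0 0\<close> is not covered by \<open>T_perm\<close>, so the base point
    gets the value 1.\<close>
  define x where "x j = (if j = 0 then 1 else T 0 j / \<tau>)" for j
  have x0: "x j \<noteq> 0" if "j < p" for j using T0[of 0 j] that tau0 p5 by (simp add: x_def)
  have T1: "T j k = \<tau> * x k / x j" if "j < p" "k < p" "j \<noteq> k" "j \<noteq> 0" for j k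
  proof (cases "k = 0")
    case False
    thus ?thesis using tau[of 0 j k] that tau0 T0[of 0 j] by (simp add: x_def field_simps)
  next
    case True
    \<comment> \<open>The rule \<open>tau\<close> needs three distinct points and excludes (0,j,0);
      a detour through l yields T j 0 T 0 j = \<tau>^2.\<close>
    have "card {0,j} \<le> 2" by (simp add: card_insert_if)
    then obtain l where l: "l < p" "l \<noteq> 0" "l \<noteq> j" using avoid[of "{0,j}"] p5 by auto
    have 1: "T 0 j * T j l = \<tau> * T 0 l" using tau l that by simp
    have 2: "T j 0 * T 0 l = \<tau> * T j l" using tau l that by simp
    have nz: "T 0 j \<noteq> 0" "T 0 l \<noteq> 0" using T0 l that by auto
    have "T j 0 * T 0 j * T 0 l = \<tau> * \<tau> * T 0 l" using 1 2 by (metis mult.assoc mult.commute)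
    hence "T j 0 * T 0 j = \<tau> * \<tau>" using nz by simp
    thus ?thesis using True that nz tau0 by (simp add: x_def field_simps)
  qed
  have T: "T j k = \<tau> * x k / x j" if "j < p" "k < p" "j \<noteq> k" for j k
    using T1[OF that] that tau0 by (cases "j = 0") (auto simp: x_def)
  have "\<rho> t i j = (x (t i) / x (t j)) / (x i / x j)" if t: "t permutes {..<p}" and ij: "i < p" "j < p" for t i j
  proof -
    have tij: "t i < p" "t j < p" using permutes_less[OF t] ij by auto
    show ?thesis
    proof (cases "i = j")
      case True
      thus ?thesis using self[OF t ij(1)] x0 tij ij by simp
    next
      case False
      hence "t j \<noteq> t i" using permutes_inj[OF t] by (auto dest: injD)
      thus ?thesis
        using T_perm(1)[OF ij(2,1) _ t] T[OF tij(2,1)] T[OF ij(2,1)] False tau0 x0[OF ij(1)] x0[OF ij(2)]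
          x0[OF tij(1)] x0[OF tij(2)]
        by (simp add: field_simps)
    qed
  qed
  thus thesis using that x0 by blast
qed

end

section \<open>Classification\<close>

lemma exists_complex_nth_root:
  assumes "0 < n"
  shows "\<exists>z::complex. z ^ n = c"
proof
  have "rcis (root n (cmod c)) (Arg c / n) ^ n = rcis (cmod c) (Arg c)"
    using assms by (simp add: DeMoivre2 real_root_pow_pos2)
  thus "rcis (root n (cmod c)) (Arg c / n) ^ n = c" by (simp add: rcis_cmod_Arg)
qed

text \<open>The line through v is invariant and cannot contain the first two unit vectors at
  once.\<close>

lemma not_irreducible_if_common_eigenvector:
  assumes p: "2 \<le> p" and v: "v \<in> carrier_vec p" "v \<noteq> 0\<^sub>v p"
    and G: "G \<subseteq> carrier_mat p p" "\<And>g. g \<in> G \<Longrightarrow> \<exists>c. g *\<^sub>v v = c \<cdot>\<^sub>v v"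
  shows "\<not> irreducible_mats p G"
proof
  assume irr: "irreducible_mats p G"
  let ?W = "range (\<lambda>c. c \<cdot>\<^sub>v v)"
  have "invariant_subspace p G ?W"
    unfolding invariant_subspace_def
  proof (intro conjI ballI allI)
    show "?W \<subseteq> carrier_vec p" using v by auto
    have "0\<^sub>v p = 0 \<cdot>\<^sub>v v" using v by auto
    thus "0\<^sub>v p \<in> ?W" by blast
  next
    fix x y assume "x \<in> ?W" "y \<in> ?W"
    then obtain c d where "x = c \<cdot>\<^sub>v v" "y = d \<cdot>\<^sub>v v" by auto
    hence "x + y = (c + d) \<cdot>\<^sub>v v" by (simp add: add_smult_distrib_vec)
    thus "x + y \<in> ?W" by blast
  next
    fix c x assume "x \<in> ?W"
    thus "c \<cdot>\<^sub>v x \<in> ?W" by (auto simp: smult_smult_assoc)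
  next
    fix g x assume g: "g \<in> G" and "x \<in> ?W"
    then obtain c where x: "x = c \<cdot>\<^sub>v v" by auto
    obtain d where "g *\<^sub>v v = d \<cdot>\<^sub>v v" using G g by blast
    moreover have "g *\<^sub>v (c \<cdot>\<^sub>v v) = c \<cdot>\<^sub>v (g *\<^sub>v v)"
      using G g v by (intro mult_mat_vec) auto
    ultimately show "g *\<^sub>v x \<in> ?W" by (auto simp: x smult_smult_assoc)
  qed
  moreover have "?W \<noteq> {0\<^sub>v p}" using v(2) by (metis one_smult_vec rangeI singletonD)
  ultimately have W: "?W = carrier_vec p" using irr by (auto simp: irreducible_mats_def)
  have "unit_vec p 0 \<in> ?W" "unit_vec p 1 \<in> ?W" unfolding W by auto
  then obtain c d where "unit_vec p 0 = c \<cdot>\<^sub>v v" "unit_vec p 1 = d \<cdot>\<^sub>v v" by auto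
  hence "unit_vec p 0 $ 0 = c * v $ 0" "unit_vec p 0 $ 1 = c * v $ 1"
    "unit_vec p 1 $ 0 = d * v $ 0" "unit_vec p 1 $ 1 = d * v $ 1"
    using v p by auto
  thus False using p by (auto simp: unit_vec_def)
qed

lemma matgroup_conj:
  assumes G: "matgroup p G" and X: "X \<in> carrier_mat p p" and Y: "Y \<in> carrier_mat p p"
    and XY: "X * Y = 1\<^sub>m p" and YX: "Y * X = 1\<^sub>m p"
  shows "matgroup p ((\<lambda>g. X * g * Y) ` G)"
proof -
  have Gc: "g \<in> carrier_mat p p" if "g \<in> G" for g using G that by (auto simp: matgroup_def)
  have mult: "(X * g * Y) * (X * h * Y) = X * (g * h) * Y" if "g \<in> G" "h \<in> G" for g h
    using conj_mat_mult[OF X Y YX] Gc that by blast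
  have one: "X * 1\<^sub>m p * Y = 1\<^sub>m p" using X XY by simp
  show ?thesis unfolding matgroup_def
  proof (intro conjI ballI)
    show "(\<lambda>g. X * g * Y) ` G \<subseteq> carrier_mat p p" using X Y Gc by auto
    have "1\<^sub>m p \<in> G" using G by (simp add: matgroup_def)
    thus "1\<^sub>m p \<in> (\<lambda>g. X * g * Y) ` G" using one by (metis imageI)
  next
    fix x y assume "x \<in> (\<lambda>g. X * g * Y) ` G" "y \<in> (\<lambda>g. X * g * Y) ` G"
    then obtain g h where gh: "g \<in> G" "h \<in> G" "x = X * g * Y" "y = X * h * Y" by auto
    moreover have "g * h \<in> G" using gh G by (auto simp: matgroup_def)
    ultimately show "x * y \<in> (\<lambda>g. X * g * Y) ` G" using mult[OF gh(1,2)] by auto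
  next
    fix x assume "x \<in> (\<lambda>g. X * g * Y) ` G"
    then obtain g where g: "g \<in> G" "x = X * g * Y" by auto
    obtain h where h: "h \<in> G" "g * h = 1\<^sub>m p" "h * g = 1\<^sub>m p" using G g by (auto simp: matgroup_def)
    show "\<exists>y\<in>(\<lambda>g. X * g * Y) ` G. x * y = 1\<^sub>m p \<and> y * x = 1\<^sub>m p"
      using mult[OF g(1) h(1)] mult[OF h(1) g(1)] g h one by auto
  qed
qed

section \<open>Normalizing the lifts by a diagonal conjugation\<close>

locale full_monomial_group = monomial_group p G for p G +
  assumes finG: "finite G" and full: "perm_part p G = Sym p" and p5: "5 \<le> p"
begin

definition D :: "complex mat set" where "D = G \<inter> diag_mats p"

lemma diag_mem_iff: "mon p a id \<in> D \<longleftrightarrow> mon p a id \<in> G"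
  using entry_nonzero by (auto simp: D_def intro: mon_id_in_diag_mats)

lemma lift_exists:
  assumes "t permutes {..<p}"
  shows "\<exists>d. mon p d t \<in> G"
  using assms full by (auto simp: perm_part_eq Sym_def)

sublocale D: sym_diag_group p D
proof unfold_locales
  show "D \<subseteq> monomial_mats p" "finite D" "D \<subseteq> diag_mats p" using monomial finG by (auto simp: D_def)
  show "mon p (a \<circ> t) id \<in> D" if "t permutes {..<p}" "mon p a id \<in> D" for t a
    using lift_exists[OF that(1)] that diag_conj_mem diag_mem_iff by metis
  have id: "\<exists>a. x = mon p a id" if "x \<in> D" for x
    using diag_mat_eq_mon that by (auto simp: D_def)
  show "matgroup p D" unfolding matgroup_def
  proof (intro conjI ballI)
    show "D \<subseteq> carrier_mat p p" by (auto simp: D_def diag_mats_def)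
    show "1\<^sub>m p \<in> D" unfolding mon_one[symmetric] diag_mem_iff by (rule one_mem)
  next
    fix x y assume "x \<in> D" "y \<in> D"
    then obtain a b where ab: "x = mon p a id" "y = mon p b id" "mon p a id \<in> G" "mon p b id \<in> G"
      using id diag_mem_iff by metis
    have "x * y = mon p (\<lambda>i. a i * b i) id" by (simp add: ab mon_mult[OF permutes_id])
    thus "x * y \<in> D" using diag_mult_mem[OF ab(3,4) refl] diag_mem_iff by simp
  next
    fix x assume x: "x \<in> D"
    then obtain a where a: "x = mon p a id" using id by metis
    have aG: "mon p a id \<in> G" using x a diag_mem_iff by simp
    have nz: "a i \<noteq> 0" if "i < p" for i using entry_nonzero[OF aG that] .
    have "mon p (\<lambda>i. inverse (a (pinv id i))) (pinv id) \<in> D"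
      using inverse_mem[OF aG permutes_id] diag_mem_iff by simp
    thus "\<exists>y\<in>D. x * y = 1\<^sub>m p \<and> y * x = 1\<^sub>m p"
      using mon_inverse[of id p a, OF permutes_id nz] a by blast
  qed
qed

lemma p2: "2 \<le> p" using p5 by simp

text \<open>The \<open>m\<close>-th powers of the entry ratios, with \<open>m\<close> the order of the ratio group of \<open>D\<close>, do not
  depend on the choice of the lift, so they form a cocycle.\<close>

lemma exists_normalizing_diag:
  obtains y where "\<And>i. i < p \<Longrightarrow> y i \<noteq> 0"
    "\<And>d t i j. t permutes {..<p} \<Longrightarrow> mon p d t \<in> G \<Longrightarrow> i < p \<Longrightarrow> j < p
      \<Longrightarrow> (d i * y i / y (t i)) / (d j * y j / y (t j)) \<in> D.ratios"
proof -
  define m where "m = card D.ratios"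
  have m: "0 < m" and Dm: "x \<in> D.ratios \<longleftrightarrow> x ^ m = 1" for x
    using D.card_ratios_pos[OF p2] D.ratios_eq_roots[OF p2] by (auto simp: m_def)
  define \<delta> where "\<delta> t = (SOME d. mon p d t \<in> G)" for t
  have \<delta>: "mon p (\<delta> t) t \<in> G" if "t permutes {..<p}" for t
    unfolding \<delta>_def using lift_exists[OF that] by (rule someI_ex)
  define \<rho> where "\<rho> t i j = (\<delta> t i / \<delta> t j) ^ m" for t i j
  have indep: "(d i / d j) ^ m = (e i / e j) ^ m"
    if "t permutes {..<p}" "mon p d t \<in> G" "mon p e t \<in> G" "i < p" "j < p" for d e t i j
  proof -
    have nz: "d i \<noteq> 0" "d j \<noteq> 0" "e i \<noteq> 0" "e j \<noteq> 0" using entry_nonzero that by auto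
    have "mon p (\<lambda>i. d i / e i) id \<in> D"
      using quotient_mem[OF that(2,3,1) refl] diag_mem_iff by simp
    hence "((d i / e i) / (d j / e j)) ^ m = 1"
      using D.ratio_mem that p2 Dm by blast
    hence "((d i / d j) / (e i / e j)) ^ m = 1" using nz by (simp add: field_simps)
    thus ?thesis using nz by (simp add: power_divide field_simps)
  qed
  interpret projective_cocycle p \<rho>
  proof unfold_locales
    fix t i j assume t: "t permutes {..<p}" and ij: "i < p" "j < p"
    show "\<rho> t i j \<noteq> 0" using entry_nonzero[OF \<delta>[OF t]] ij by (simp add: \<rho>_def)
    fix u assume u: "u permutes {..<p}"
    have "mon p (\<lambda>i. \<delta> t i * \<delta> u (t i)) (u \<circ> t) \<in> G" by (rule mult_mem[OF \<delta>[OF t] \<delta>[OF u] t refl])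
    from indep[OF permutes_compose[OF t u] \<delta>[OF permutes_compose[OF t u]] this ij]
    show "\<rho> (u \<circ> t) i j = \<rho> t i j * \<rho> u (t i) (t j)"
      by (simp add: \<rho>_def flip: power_mult_distrib)
  next
    fix t i j k assume "t permutes {..<p}" "i < p" "j < p" "k < p"
    thus "\<rho> t i j * \<rho> t j k = \<rho> t i k"
      using entry_nonzero[OF \<delta>] by (simp add: \<rho>_def flip: power_mult_distrib)
  qed (fact p5)
  obtain x where x: "\<And>i. i < p \<Longrightarrow> x i \<noteq> 0"
    "\<And>t i j. t permutes {..<p} \<Longrightarrow> i < p \<Longrightarrow> j < p
      \<Longrightarrow> \<rho> t i j = (x (t i) / x (t j)) / (x i / x j)" by (rule coboundary) blast
  \<comment> \<open>Any m-th roots will do: another choice changes each y_i by an m-th root of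
    unity, that is, by an element of the ratio group.\<close>
  define y where "y i = (SOME z. z ^ m = x i)" for i
  have y: "y i ^ m = x i" for i
    unfolding y_def by (rule someI_ex[OF exists_complex_nth_root[OF m]])
  have y0: "y i \<noteq> 0" if "i < p" for i using y[of i] x(1)[OF that] m by (auto simp: zero_power)
  have "(d i * y i / y (t i)) / (d j * y j / y (t j)) \<in> D.ratios"
    if t: "t permutes {..<p}" and d: "mon p d t \<in> G" and ij: "i < p" "j < p" for d t i j
  proof -
    have tij: "t i < p" "t j < p" using permutes_less[OF t] ij by auto
    have "(d i / d j) ^ m = \<rho> t i j" using indep[OF t d \<delta>[OF t] ij] by (simp add: \<rho>_def)
    also have "\<dots> = ((y (t i) / y (t j)) / (y i / y j)) ^ m"
      using x(2)[OF t ij] by (simp add: y power_divide power_mult_distrib)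
    finally have eq: "(d i / d j) ^ m = ((y (t i) / y (t j)) / (y i / y j)) ^ m" .
    have "(y (t i) / y (t j)) / (y i / y j) \<noteq> 0" using y0 tij ij by simp
    hence "((d i / d j) / ((y (t i) / y (t j)) / (y i / y j))) ^ m = 1"
      by (subst power_divide) (simp only: eq divide_self power_not_zero not_False_eq_True)
    moreover have "(d i / d j) / ((y (t i) / y (t j)) / (y i / y j))
        = (d i * y i / y (t i)) / (d j * y j / y (t j))"
      using y0 tij ij entry_nonzero[OF d] by (simp add: field_simps)
    ultimately show ?thesis using Dm by simp
  qed
  thus thesis using that y0 by blast
qed

text \<open>With trivial ratio group every normalized lift is a scalar times a permutation matrix
  and preserves the line of the all-ones vector; the entries 1/y_i undo the normalization.\<close>

lemma irreducible_imp_nontrivial_ratio: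
  assumes "irreducible_mats p G"
  shows "\<exists>x\<in>D.ratios. x \<noteq> 1"
proof (rule ccontr)
  assume "\<not> (\<exists>x\<in>D.ratios. x \<noteq> 1)"
  hence triv: "x = 1" if "x \<in> D.ratios" for x using that by blast
  obtain y where y: "\<And>i. i < p \<Longrightarrow> y i \<noteq> 0"
    "\<And>d t i j. t permutes {..<p} \<Longrightarrow> mon p d t \<in> G \<Longrightarrow> i < p \<Longrightarrow> j < p
      \<Longrightarrow> (d i * y i / y (t i)) / (d j * y j / y (t j)) \<in> D.ratios"
    using exists_normalizing_diag by blast
  let ?v = "vec p (\<lambda>i. inverse (y i))"
  have "?v \<noteq> 0\<^sub>v p"
  proof
    assume "?v = 0\<^sub>v p"
    hence "?v $ 0 = 0" using p5 by simp
    thus False using y(1)[of 0] p5 by simp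
  qed
  moreover have "\<exists>c. g *\<^sub>v ?v = c \<cdot>\<^sub>v ?v" if g: "g \<in> G" for g
  proof -
    obtain d t where d: "t permutes {..<p}" "g = mon p d t" using mem_monE[OF g] by blast
    have dG: "mon p d t \<in> G" using d g by simp
    define c where "c = d 0 * y 0 / y (t 0)"
    have "d i * inverse (y (t i)) = c * inverse (y i)" if i: "i < p" for i
    proof -
      have ti: "t i < p" "t 0 < p" using permutes_less[OF d(1)] i p5 by auto
      have "(d i * y i / y (t i)) / c = 1"
        using triv[OF y(2)[OF d(1) dG i, of 0]] p5 by (simp add: c_def)
      hence "d i * y i / y (t i) = c" by (metis divide_eq_1_iff)
      thus ?thesis using y(1)[OF i] y(1)[OF ti(1)] by (simp add: field_simps)
    qed
    hence "g *\<^sub>v ?v = c \<cdot>\<^sub>v ?v"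
      unfolding d(2) using permutes_less[OF d(1)]
      by (intro eq_vecI) (simp_all add: mon_mult_vec[OF d(1)])
    thus ?thesis by blast
  qed
  moreover have "G \<subseteq> carrier_mat p p" using monomial by (auto simp: monomial_mats_def)
  ultimately have "\<not> irreducible_mats p G"
    by (intro not_irreducible_if_common_eigenvector[OF p2, of ?v]) auto
  thus False using assms by simp
qed

end

lemma sym_diag_group_imp_admissible_A:
  assumes "sym_diag_group p A" "\<exists>x\<in>sym_diag_group.ratios p A. x \<noteq> 1" "3 \<le> p"
  shows "admissible_A p A"
proof -
  interpret sym_diag_group p A by fact
  have "perm_mat p t * g * perm_mat p (pinv t) \<in> A" if t: "t permutes {..<p}" and g: "g \<in> A" for t g
  proof -
    obtain a where a: "g = mon p a id" using mem_diagE[OF g] .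
    have "perm_mat p t * g * perm_mat p (pinv t) = mon p (a \<circ> t) id"
      by (simp add: a perm_mat_eq_mon mon_mult[OF t] permutes_inv_o[OF t] comp_def[of a])
    thus ?thesis using sym[OF t] g a by simp
  qed
  thus ?thesis
    using assms nonscalar_iff matgroup fin diag by (auto simp: admissible_A_def Sym_def)
qed

text \<open>After normalization the coefficients of the lifts modulo \<open>D\<close> live in a group on which
  \<open>Sym(p)\<close> acts trivially, so the lifts are governed by a single homomorphism of \<open>Sym(p)\<close> to an
  abelian group.\<close>

locale normalized_group = full_monomial_group p G for p G +
  assumes lift_ratio: "\<And>d t i j. t permutes {..<p} \<Longrightarrow> mon p d t \<in> G \<Longrightarrow> i < p \<Longrightarrow> j < p
      \<Longrightarrow> d i / d j \<in> D.ratios"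
    and odd: "odd p"
begin

text \<open>The permutation u is arbitrary and unrelated to t: modulo D the coefficients of a lift
  may be permuted freely.\<close>

lemma lift_conj_mem:
  assumes "t permutes {..<p}" "mon p d t \<in> G" "u permutes {..<p}"
  shows "mon p (\<lambda>i. d (u i) / d i) id \<in> G"
  using D.ratio_vector_conj_mem[where e = d, OF p2 entry_nonzero[OF assms(2)] lift_ratio[OF assms(1,2)] assms(3)]
  by (simp add: diag_mem_iff)

lemma scalar_lift_of_involution:
  assumes t: "t permutes {..<p}" "t \<circ> t = id"
  obtains c where "mon p (\<lambda>_. c) t \<in> G" "mon p (\<lambda>_. c\<^sup>2) id \<in> G"
proof -
  obtain e where e: "mon p e t \<in> G" using lift_exists[OF t(1)] by blast
  have nz: "e i \<noteq> 0" if "i < p" for i using entry_nonzero[OF e that] .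
  define c where "c = (\<Prod>k<p. e k)"
  have c0: "c \<noteq> 0" using nz by (simp add: c_def)
  \<comment> \<open>This is the square of the lift; dividing it by e(t i)/e(i), which lies in D,
    leaves e_i^2.\<close>
  have "mon p (\<lambda>i. e i * e (t i)) id \<in> G" using mult_mem[OF e e t(1) refl] t(2) by simp
  from diag_divide_mem[OF this lift_conj_mem[OF t(1) e t(1)] refl]
  have "mon p (\<lambda>i. (e i)\<^sup>2) id \<in> G"
    by (rule mem_cong) (use nz permutes_less[OF t(1)] in \<open>simp add: power2_eq_square\<close>)
  from diag_power_mem[OF this refl, of "(p - 1) div 2"]
  have 1: "mon p (\<lambda>i. e i ^ (p - 1)) id \<in> G"
    using odd by (simp flip: power_mult)
  have 2: "mon p (\<lambda>i. e i ^ p / c) id \<in> G"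
    using D.ratio_vector_power_mem[where e = e, OF p2 nz lift_ratio[OF t(1) e]]
    by (simp add: diag_mem_iff c_def)
  \<comment> \<open>The quotient of e_i^(p-1) by e_i^p/c is c/e_i, which replaces each coefficient
    e_i of the lift by c.\<close>
  from diag_mult_mem[OF diag_divide_mem[OF 1 2 refl] e refl] have 3: "mon p (\<lambda>_. c) t \<in> G"
  proof (rule mem_cong)
    fix i assume i: "i < p"
    have "e i ^ p = e i * e i ^ (p - 1)" using p5 by (cases p) auto
    thus "e i ^ (p - 1) / (e i ^ p / c) * e i = c" using nz[OF i] by simp
  qed
  have "mon p (\<lambda>_. c\<^sup>2) (t \<circ> t) \<in> G"
    by (rule mult_mem[OF 3 3 t(1)]) (simp add: power2_eq_square)
  thus thesis using that 3 t(2) by simp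
qed

lemma scalar_finite_order:
  assumes "mon p (\<lambda>_. c) id \<in> G"
  obtains N where "0 < N" "c ^ N = 1"
proof -
  let ?S = "{c. mon p (\<lambda>_. c) id \<in> G}"
  have inj: "inj_on (\<lambda>c. mon p (\<lambda>_. c) id) ?S"
  proof (rule inj_onI)
    fix c d assume "mon p (\<lambda>_. c) id = mon p (\<lambda>_. d) id"
    hence "mon p (\<lambda>_. c) id $$ (0,0) = mon p (\<lambda>_. d) id $$ (0,0)" by simp
    thus "c = d" using p5 by simp
  qed
  have fin: "finite ?S" by (rule finite_imageD[OF finite_subset[OF _ finG] inj]) auto
  have ne: "?S \<noteq> {}" using one_mem by auto
  have "?S = {z. z ^ card ?S = 1}"
  proof (rule finite_subgroup_eq_roots_of_unity[OF fin ne])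
    show "0 \<notin> ?S" using entry_nonzero[of "\<lambda>_. 0" id 0] p5 by auto
    show "x * y \<in> ?S" if "x \<in> ?S" "y \<in> ?S" for x y
      using that by (auto intro: diag_mult_mem)
  qed
  moreover have "0 < card ?S" using fin ne by (simp add: card_gt_0_iff)
  ultimately show thesis using that assms by blast
qed

text \<open>With l the odd part of an exponent of c^2, the scalar w = c^l still lifts t, and w^2 has
  2-power order, so w^(2^n) is 1 or -1. In the first case w lies in D and is divided out; in the
  second, w differs from z_{2^(n+1)} by a 2^n-th root of unity, which is in D.\<close>

lemma star_lift_of_transposition:
  assumes t: "t permutes {..<p}" "t \<circ> t = id"
  obtains w where "mon p (\<lambda>_. w) t \<in> G" "mon p (\<lambda>_. w\<^sup>2) id \<in> G"
    "w = 1 \<or> (\<exists>n. card (D \<inter> Z2 p) = 2 ^ n \<and> w = cis (2 * pi / real (2 ^ (n + 1))))"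
proof -
  obtain c where c: "mon p (\<lambda>_. c) t \<in> G" "mon p (\<lambda>_. c\<^sup>2) id \<in> G"
    using scalar_lift_of_involution[OF t] by blast
  obtain N where N: "0 < N" "(c\<^sup>2) ^ N = 1" using scalar_finite_order[OF c(2)] by blast
  obtain k l where l: "N = 2 ^ k * l" "odd l"
  proof -
    have "\<exists>k l. N = 2 ^ k * l \<and> odd l"
      using N(1)
    proof (induction N rule: less_induct)
      case (less N)
      show ?case
      proof (cases "even N")
        case True
        then obtain M where M: "N = 2 * M" by (elim evenE)
        hence "\<exists>k l. M = 2 ^ k * l \<and> odd l" using less.IH[of M] less.prems by auto
        then obtain k l where "M = 2 ^ k * l \<and> odd l" by blast
        hence "N = 2 ^ Suc k * l \<and> odd l" using M by simp
        thus ?thesis by blast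
      next
        case False
        hence "N = 2 ^ 0 * N \<and> odd N" by simp
        thus ?thesis by blast
      qed
    qed
    thus thesis using that by blast
  qed
  obtain n where n: "card (D \<inter> Z2 p) = 2 ^ n" using D.card_Z2_part_power_of_2 p5 by auto
  have iff: "mon p (\<lambda>_. x) id \<in> G" if "x ^ (2 ^ n) = 1" for x
    using D.two_scalar_mem_iff[OF _ n, of x] that p5 by (auto simp: diag_mem_iff)
  define w where "w = c ^ l"
  obtain q where q: "l = 2 * q + 1" using l(2) by (elim oddE)
  have "w = (c\<^sup>2) ^ q * c" by (simp add: w_def q power_mult)
  hence w: "mon p (\<lambda>_. w) t \<in> G"
    using diag_mult_mem[OF diag_power_mem[OF c(2) refl, of q] c(1) refl] by simp
  have w2: "mon p (\<lambda>_. w\<^sup>2) id \<in> G"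
    using diag_power_mem[OF c(2) refl, of l] by (simp add: w_def mult.commute flip: power_mult)
  have "(w\<^sup>2) ^ (2 ^ k) = (c\<^sup>2) ^ N" by (simp add: w_def l mult_ac flip: power_mult)
  hence "(w\<^sup>2) ^ (2 ^ k) = 1" using N by simp
  hence "(w\<^sup>2) ^ (2 ^ n) = 1"
    using D.two_scalar_mem_iff[OF _ n, of "w\<^sup>2"] w2 p5 by (auto simp: diag_mem_iff)
  hence "(w ^ (2 ^ n))\<^sup>2 = 1" by (simp add: mult.commute flip: power_mult)
  hence "w ^ (2 ^ n) = 1 \<or> w ^ (2 ^ n) = -1" by (simp add: power2_eq_1_iff)
  thus thesis
  proof
    assume "w ^ (2 ^ n) = 1"
    hence "mon p (\<lambda>_. w) id \<in> G" by (rule iff)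
    from diag_mult_mem[OF diag_inverse_mem[OF this refl] w refl]
    have "mon p (\<lambda>_. 1) t \<in> G"
      by (rule mem_cong) (use entry_nonzero[OF w] in auto)
    thus thesis using that[of 1] one_mem by simp
  next
    assume w1: "w ^ (2 ^ n) = -1"
    let ?z = "cis (2 * pi / real (2 ^ (n + 1)))"
    have "(?z / w) ^ (2 ^ n) = 1" by (simp only: power_divide w1 cis_power_half) simp
    hence zw: "mon p (\<lambda>_. ?z / w) id \<in> G" by (rule iff)
    have z: "mon p (\<lambda>_. ?z) t \<in> G"
      by (rule mem_cong[OF diag_mult_mem[OF zw w refl]]) (use entry_nonzero[OF w] in auto)
    have "mon p (\<lambda>_. ?z\<^sup>2) (t \<circ> t) \<in> G"
      by (rule mult_mem[OF z z t(1)]) (simp add: power2_eq_square)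
    hence "mon p (\<lambda>_. ?z\<^sup>2) id \<in> G" using t(2) by simp
    thus thesis using that[OF z] n by blast
  qed
qed

text \<open>One w serves all transpositions: conjugating the lift of (0 1) by a lift f of some u
  gives (a b) with coefficients w f(i)/f(t i), and \<open>lift_conj_mem\<close> removes the
  quotient.\<close>

lemma eq_ext_group:
  obtains w where "G = ext_group p D w"
    "w = 1 \<or> (\<exists>n. card (D \<inter> Z2 p) = 2 ^ n \<and> w = cis (2 * pi / real (2 ^ (n + 1))))"
proof -
  let ?r = "Transposition.transpose 0 (1::nat)"
  have r: "?r permutes {..<p}" using p5 by (intro permutes_swap_id) auto
  obtain w where w: "mon p (\<lambda>_. w) ?r \<in> G" "mon p (\<lambda>_. w\<^sup>2) id \<in> G"
    "w = 1 \<or> (\<exists>n. card (D \<inter> Z2 p) = 2 ^ n \<and> w = cis (2 * pi / real (2 ^ (n + 1))))"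
    using star_lift_of_transposition[OF r] by auto
  have w0: "w \<noteq> 0" using entry_nonzero[OF w(1), of 0] p5 by simp
  have tr: "mon p (\<lambda>_. w) (Transposition.transpose a b) \<in> G" if ab: "a < p" "b < p" "a \<noteq> b" for a b
  proof -
    let ?t = "Transposition.transpose a b"
    have t: "?t permutes {..<p}" using ab by (intro permutes_swap_id) auto
    obtain u where u: "u permutes {..<p}" "u a = 0" "u b = 1"
      using permutation_through2[of a p b 0 1] ab p5 by auto
    obtain f where f: "mon p f u \<in> G" using lift_exists[OF u(1)] by blast
    have eq: "pinv u \<circ> (?r \<circ> u) = ?t"
    proof
      fix i
      have "?r (u i) = u (?t i)"
        using transpose_apply_commute[OF permutes_bij[OF u(1)], of 0 1 i] u
        by (metis permutes_inverses(2))
      thus "(pinv u \<circ> (?r \<circ> u)) i = ?t i" using permutes_inverses(2)[OF u(1)] by simp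
    qed
    have "mon p (\<lambda>i. f i * w) (?r \<circ> u) \<in> G" by (rule mult_mem[OF f w(1) u(1)]) simp
    from mult_mem[OF this inverse_mem[OF f u(1)] permutes_compose[OF u(1) r] refl]
    have "mon p (\<lambda>i. f i * w * inverse (f (?t i))) ?t \<in> G"
      unfolding eq using eq by (metis (no_types, lifting) comp_apply mem_cong)
    from diag_mult_mem[OF lift_conj_mem[OF u(1) f t] this refl] show ?thesis
      by (rule mem_cong) (use entry_nonzero[OF f] permutes_less[OF t] in simp)
  qed
  have lift: "mon p (\<lambda>_. twist w t) t \<in> G" if "t permutes {..<p}" for t
    using twisted_transpositions_imp_perms[OF w0 w(2) tr that] by simp
  interpret E: twisted_ext p D w
    using w(2) p2 by unfold_locales (simp_all only: diag_mem_iff)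
  have "ext_group p D w \<subseteq> G"
    by (rule E.ext_subset[OF monomial_group_axioms _ lift]) (auto simp: D_def)
  moreover have "G \<subseteq> ext_group p D w"
  proof
    fix g assume g: "g \<in> G"
    obtain d t where d: "t permutes {..<p}" "g = mon p d t" using mem_monE[OF g] by blast
    have "mon p (\<lambda>i. d i / twist w t) id \<in> G"
      using quotient_mem[OF _ lift[OF d(1)] d(1) refl] g d(2) by simp
    thus "g \<in> ext_group p D w" using E.ext_mem_iff[OF d(1)] by (simp add: d(2) diag_mem_iff)
  qed
  ultimately show thesis using that w(3) by blast
qed

end

text \<open>Conjugation by the diagonal matrix y fixes all diagonal matrices, so G and its conjugate
  H share their ratio group; the bound for G from \<open>exists_normalizing_diag\<close> thus
  becomes the defining condition of \<open>normalized_group\<close> for H.\<close>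

lemma conjugate_to_R_star:
  assumes "odd p" "5 \<le> p" "matgroup p G" "finite G" "G \<subseteq> monomial_mats p"
    and irr: "irreducible_mats p G" and "perm_part p G = Sym p"
  shows "\<exists>H\<in>R_star p. GL_conjugate p G H"
proof -
  interpret G: full_monomial_group p G using assms by unfold_locales auto
  obtain y where y: "\<And>i. i < p \<Longrightarrow> y i \<noteq> 0"
    "\<And>d t i j. t permutes {..<p} \<Longrightarrow> mon p d t \<in> G \<Longrightarrow> i < p \<Longrightarrow> j < p
      \<Longrightarrow> (d i * y i / y (t i)) / (d j * y j / y (t j)) \<in> G.D.ratios"
    using G.exists_normalizing_diag by blast
  define X where "X = mon p y id"
  define Y where "Y = mon p (\<lambda>i. inverse (y i)) id"
  have XY: "X * Y = 1\<^sub>m p" "Y * X = 1\<^sub>m p"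
    unfolding X_def Y_def mon_mult[OF permutes_id] mon_one[symmetric] using y(1)
    by (auto intro!: mon_cong)
  have XYc: "X \<in> carrier_mat p p" "Y \<in> carrier_mat p p" by (auto simp: X_def Y_def)
  define H where "H = (\<lambda>g. X * g * Y) ` G"
  have conj: "X * mon p d t * Y = mon p (\<lambda>i. d i * y i / y (t i)) t" if "t permutes {..<p}" for d t
    unfolding X_def Y_def mon_mult[OF permutes_id] using that
    by (simp add: mon_mult divide_inverse mult_ac)
  have memH: "\<exists>d. mon p d t \<in> G \<and> g = mon p (\<lambda>i. d i * y i / y (t i)) t \<and> t permutes {..<p}"
    if "mon p e t \<in> H" "t permutes {..<p}" "g = mon p e t" for g e t
  proof -
    from that(1) obtain h where h: "h \<in> G" "mon p e t = X * h * Y" by (auto simp: H_def)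
    obtain d u where u: "u permutes {..<p}" "h = mon p d u" using G.mem_monE[OF h(1)] by blast
    have dG: "mon p d u \<in> G" using h u by simp
    have eq: "mon p (\<lambda>i. d i * y i / y (u i)) u = mon p e t" using h(2) conj[OF u(1)] u(2) by simp
    have "u = t"
      by (rule mon_eqD(1)[OF eq u(1) that(2)])
        (use G.entry_nonzero[OF dG] y(1) permutes_less[OF u(1)] in simp)
    thus ?thesis using dG eq u that(3) by auto
  qed
  have Hmon: "H \<subseteq> monomial_mats p"
  proof
    fix g assume "g \<in> H"
    then obtain h where h: "h \<in> G" "g = X * h * Y" by (auto simp: H_def)
    obtain d u where u: "u permutes {..<p}" "h = mon p d u" using G.mem_monE[OF h(1)] by blast
    have dG: "mon p d u \<in> G" using h u by simp
    show "g \<in> monomial_mats p" unfolding h u conj[OF u(1)]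
      using G.entry_nonzero[OF dG] y(1) permutes_less[OF u(1)] u(1)
      by (intro mon_in_monomial_mats) auto
  qed
  interpret H0: monomial_group p H
    using matgroup_conj[OF assms(3) XYc XY] Hmon by unfold_locales (auto simp: H_def)
  have "perm_part p H = Sym p"
  proof -
    have "\<exists>d. mon p d t \<in> H" if t: "t permutes {..<p}" for t
    proof -
      obtain d where "mon p d t \<in> G" using G.lift_exists[OF t] by blast
      hence "X * mon p d t * Y \<in> H" by (auto simp: H_def)
      thus ?thesis using conj[OF t] by auto
    qed
    thus ?thesis by (auto simp: H0.perm_part_eq Sym_def)
  qed
  then interpret H: full_monomial_group p H
    using assms by unfold_locales (auto simp: H_def)
  have diag: "mon p a id \<in> H \<longleftrightarrow> mon p a id \<in> G" for a
  proof -
    have e: "X * mon p d id * Y = mon p d id" for d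
      unfolding conj[OF permutes_id] using y(1) by (intro mon_cong) simp
    show ?thesis
    proof
      assume "mon p a id \<in> H"
      from memH[OF this permutes_id refl] obtain d where
        "mon p d id \<in> G" "mon p a id = mon p (\<lambda>i. d i * y i / y (id i)) id" by blast
      thus "mon p a id \<in> G" using e[of d] conj[OF permutes_id, of d] by simp
    next
      assume "mon p a id \<in> G"
      hence "X * mon p a id * Y \<in> H" by (auto simp: H_def)
      thus "mon p a id \<in> H" by (simp only: e)
    qed
  qed
  have ratios: "H.D.ratios = G.D.ratios"
    unfolding H.D.ratios_def G.D.ratios_def H.diag_mem_iff G.diag_mem_iff diag ..
  interpret N: normalized_group p H
  proof unfold_locales
    fix e t i j assume t: "t permutes {..<p}" "mon p e t \<in> H" and ij: "i < p" "j < p"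
    obtain d where d: "mon p d t \<in> G" "mon p e t = mon p (\<lambda>i. d i * y i / y (t i)) t"
      using memH[OF t(2,1) refl] by blast
    have "e k = d k * y k / y (t k)" if "k < p" for k
      by (rule mon_eqD(2)[OF d(2) t(1) t(1) H0.entry_nonzero[OF t(2)] that])
    thus "e i / e j \<in> H.D.ratios" using y(2)[OF t(1) d(1) ij] ij ratios by simp
  qed (fact assms)
  obtain w where w: "H = ext_group p H.D w"
    "w = 1 \<or> (\<exists>n. card (H.D \<inter> Z2 p) = 2 ^ n \<and> w = cis (2 * pi / real (2 ^ (n + 1))))"
    by (rule N.eq_ext_group) blast
  have "admissible_A p H.D"
    using G.irreducible_imp_nontrivial_ratio[OF irr] ratios assms
    by (intro sym_diag_group_imp_admissible_A H.D.sym_diag_group_axioms) auto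
  hence "star_data p H.D w" using w(2) by (simp add: star_data_def)
  hence "H \<in> R_star p" using R_star_eq[of p] assms w(1) by auto
  moreover have "GL_conjugate p G H"
    unfolding GL_conjugate_def H_def using XYc XY by blast
  ultimately show ?thesis by blast
qed

theorem theorem7p9:
  fixes p :: nat
  assumes "prime p" and "p \<ge> 5"
  shows "(\<forall>G\<in>R_star p. matgroup p G \<and> finite G \<and> G \<subseteq> monomial_mats p \<and>
              irreducible_mats p G \<and> perm_part p G = Sym p)
       \<and> (\<forall>G. matgroup p G \<and> finite G \<and> G \<subseteq> monomial_mats p \<and> irreducible_mats p G \<and>
              perm_part p G = Sym p \<longrightarrow> (\<exists>H\<in>R_star p. GL_conjugate p G H))
       \<and> (\<forall>G\<in>R_star p. \<forall>H\<in>R_star p. G \<noteq> H \<longrightarrow> \<not> GL_conjugate p G H)"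
proof -
  have odd: "odd p" using assms prime_odd_nat[of p] by simp
  show ?thesis
    using R_star_properties[OF odd assms(2)] conjugate_to_R_star[OF odd assms(2)]
      R_star_not_conjugate[OF odd assms(2)] by blast
qed

end
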